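(* Let $\Omega$ be a bounded domain in $\mathbb{R}^n$, $p>1$, and let $f$ satisfy the standing assumptions, with $k=(f')^{-1}$. Let $\nu\in\mathcal{P}(\Omega)$ be of the form $\nu=\nu^s+v\cdot\mathcal{L}^n$ with $\nu^s\perp\mathcal{L}^n$, $v\in L^\infty(\Omega)$ and $v>0$ a.e. in $\Omega$. Let $\mu=u\cdot\mathcal{L}^n$ minimize $\mathfrak{F}^p_\nu$ over $\mathcal{P}(\Omega)$, and let $\psi$ be a Kantorovich potential for the transport between $\mu$ and $\nu$ with cost $|x-y|^p$ (under these hypotheses it is unique up to additive constants). Then there exists a constant $l\in\mathbb{R}$ such that $l-\psi\geq 0$ a.e. and $$u=k(l-\psi)\quad\text{a.e. in }\Omega.$$
   Context: A bounded domain is a bounded set $\Omega\subset\mathbb{R}^n$ which is the closure of a nonempty connected open set and whose boundary is Lebesgue-negligible. $\mathcal{P}(\Omega)$ is the set of Borel probability measures on $\Omega$. Standing assumptions on $f$: $f:[0,+\infty)\to[0,+\infty)$ is strictly convex and $C^1$, $f(0)=0$, $f'(0)=0$, and $\lim_{t\to+\infty}f(t)/t=+\infty$; $k=(f')^{-1}:[0,+\infty)\to[0,+\infty)$ is then continuous and strictly increasing. $T_p(\mu,\nu)=\inf_\gamma\int|x-y|^p\,d\gamma$ over transport plans $\gamma$ (probability measures on $\Omega\times\Omega$ with marginals $\mu,\nu$). $F(\mu)=\int_\Omega f(u)\,dx$ if $\mu=u\cdot\mathcal{L}^n$, $+\infty$ otherwise. $\mathfrak{F}^p_\nu(\mu)=T_p(\mu,\nu)+F(\mu)$.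 For $c(x,y)=|x-y|^p$ and $\chi:\Omega\to\mathbb{R}$, the $c$-transform is $\chi^c(y)=\inf_{x\in\Omega}\big(c(x,y)-\chi(x)\big)$; $\chi$ is $c$-concave if $\chi=\phi^c$ for some $\phi$. A Kantorovich potential between $\mu$ and $\nu$ is a $c$-concave function $\psi$ maximizing $\int\varphi\,d\mu+\int\varphi^c\,d\nu$ among $c$-concave $\varphi$; the maximum equals $T_p(\mu,\nu)$. *)

theory Defs
  imports "HOL-Probability.Probability"
begin

definition strictly_convex_on :: "real set \<Rightarrow> (real \<Rightarrow> real) \<Rightarrow> bool" where
  "strictly_convex_on S f \<longleftrightarrow> convex S \<and>
     (\<forall>x\<in>S. \<forall>y\<in>S. \<forall>t. x \<noteq> y \<and> 0 < t \<and> t < 1 \<longrightarrow>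
        f (t * x + (1 - t) * y) < t * f x + (1 - t) * f y)"

definition standing_f :: "(real \<Rightarrow> real) \<Rightarrow> (real \<Rightarrow> real) \<Rightarrow> bool" where
  "standing_f f f' \<longleftrightarrow>
     (\<forall>t\<ge>0. 0 \<le> f t) \<and>
     strictly_convex_on {0..} f \<and>
     (\<forall>t\<ge>0. (f has_real_derivative f' t) (at t within {0..})) \<and>
     continuous_on {0..} f' \<and>
     f 0 = 0 \<and> f' 0 = 0 \<and>
     filterlim (\<lambda>t. f t / t) at_top at_top"

definition bounded_domain :: "'a::euclidean_space set \<Rightarrow> bool" where
  "bounded_domain \<Omega> \<longleftrightarrow> bounded \<Omega> \<and>
     (\<exists>U. open U \<and> connected U \<and> U \<noteq> {} \<and> \<Omega> = closure U) \<and>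
     frontier \<Omega> \<in> null_sets lborel"

definition prob_on :: "'a::euclidean_space set \<Rightarrow> 'a measure set" where
  "prob_on \<Omega> = {\<mu>. sets \<mu> = sets borel \<and> prob_space \<mu> \<and> emeasure \<mu> (UNIV - \<Omega>) = 0}"

definition transport_plans :: "'a::euclidean_space measure \<Rightarrow> 'a measure \<Rightarrow> ('a \<times> 'a) measure set" where
  "transport_plans \<mu> \<nu> = {\<gamma>. sets \<gamma> = sets (borel \<Otimes>\<^sub>M borel) \<and> prob_space \<gamma> \<and>
      distr \<gamma> borel fst = \<mu> \<and> distr \<gamma> borel snd = \<nu>}"

definition Tp :: "real \<Rightarrow> 'a::euclidean_space measure \<Rightarrow> 'a measure \<Rightarrow> ennreal" where
  "Tp p \<mu> \<nu> = (INF \<gamma>\<in>transport_plans \<mu> \<nu>. \<integral>\<^sup>+ z. ennreal (dist (fst z) (snd z) powr p) \<partial>\<gamma>)"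

(* F(mu) = int_Omega f(u) dx if mu = u L^n, +oo otherwise (INF over the empty set is top) *)
definition Fen :: "(real \<Rightarrow> real) \<Rightarrow> 'a::euclidean_space set \<Rightarrow> 'a measure \<Rightarrow> ennreal" where
  "Fen f \<Omega> \<mu> = (INF u\<in>{u. u \<in> borel_measurable borel \<and> (\<forall>x. 0 \<le> u x) \<and>
                          \<mu> = density lborel (\<lambda>x. ennreal (u x))}.
                   \<integral>\<^sup>+ x\<in>\<Omega>. ennreal (f (u x)) \<partial>lborel)"

definition Ffun :: "real \<Rightarrow> (real \<Rightarrow> real) \<Rightarrow> 'a::euclidean_space set \<Rightarrow> 'a measure \<Rightarrow> 'a measure \<Rightarrow> ennreal" where
  "Ffun p f \<Omega> \<nu> \<mu> = Tp p \<mu> \<nu> + Fen f \<Omega> \<mu>"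

definition ctrans :: "'a::euclidean_space set \<Rightarrow> real \<Rightarrow> ('a \<Rightarrow> real) \<Rightarrow> 'a \<Rightarrow> real" where
  "ctrans \<Omega> p g y = (INF x\<in>\<Omega>. dist x y powr p - g x)"

definition c_concave :: "'a::euclidean_space set \<Rightarrow> real \<Rightarrow> ('a \<Rightarrow> real) \<Rightarrow> bool" where
  "c_concave \<Omega> p g \<longleftrightarrow> (\<exists>\<phi>. (\<forall>y\<in>\<Omega>. bdd_below ((\<lambda>x. dist x y powr p - \<phi> x) ` \<Omega>)) \<and>
                             (\<forall>y\<in>\<Omega>. g y = ctrans \<Omega> p \<phi> y))"

definition kant_dual :: "'a::euclidean_space set \<Rightarrow> real \<Rightarrow> 'a measure \<Rightarrow> 'a measure \<Rightarrow> ('a \<Rightarrow> real) \<Rightarrow> real" where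
  "kant_dual \<Omega> p \<mu> \<nu> \<phi> = (LINT x:\<Omega>|\<mu>. \<phi> x) + (LINT y:\<Omega>|\<nu>. ctrans \<Omega> p \<phi> y)"

definition kantorovich_potential :: "'a::euclidean_space set \<Rightarrow> real \<Rightarrow> 'a measure \<Rightarrow> 'a measure \<Rightarrow> ('a \<Rightarrow> real) \<Rightarrow> bool" where
  "kantorovich_potential \<Omega> p \<mu> \<nu> \<psi> \<longleftrightarrow> c_concave \<Omega> p \<psi> \<and>
     (\<forall>\<phi>. c_concave \<Omega> p \<phi> \<longrightarrow> kant_dual \<Omega> p \<mu> \<nu> \<phi> \<le> kant_dual \<Omega> p \<mu> \<nu> \<psi>)"

end

theory Submission
  imports Defs
begin

text \<open>
  Write \<open>c(x,y) = |x-y|\<^sup>p\<close>. A competitor for the minimum of \<open>T\<^sub>p(\<cdot>,\<nu>) + F\<close> is any plan with second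
  marginal \<open>\<nu>\<close>; its first marginal is free. Mixing a little of such a plan \<open>\<gamma>'\<close> into a nearly optimal
  plan between \<open>\<mu>\<close> and \<open>\<nu>\<close> gives \<open>T\<^sub>p(\<mu>,\<nu>) + \<integral>f'(u)u \<le> \<integral>(c + f'(u)) d\<gamma>'\<close>, and sending each \<open>y\<close>
  to an almost minimiser of \<open>c(\<cdot>,y) + f'(u)\<close> turns the right-hand side into \<open>\<integral>g d\<nu>\<close> with
  \<open>g = (-f'(u))\<^sup>c\<close>. So \<open>-f'(u)\<close> is dual optimal, \<open>\<phi> = g\<^sup>c\<close> is a Kantorovich potential,
  \<open>\<phi> \<ge> -f'(u)\<close> a.e., with equality where \<open>u > 0\<close>.

  Comparing \<open>\<phi>\<close> with \<open>min(\<phi>,0)\<close> in the dual problem gives \<open>\<phi> \<le> 0\<close>, because \<open>\<phi>(y) > 0\<close> would force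
  \<open>\<phi>\<^sup>c(y) < 0 \<le> min(\<phi>,0)\<^sup>c(y)\<close> and \<open>\<nu>\<close> has full support. Hence \<open>\<phi> = -f'(u)\<close> a.e.

  Finally \<open>\<psi> - \<phi>\<close> is constant. Optimality of the midpoint \<open>(\<phi>+\<psi>)/2\<close> yields, for every \<open>y\<close>, a common
  point \<open>x\<close> at which \<open>\<phi>\<^sup>c(y)\<close> and \<open>\<psi>\<^sup>c(y)\<close> are attained, so \<open>\<phi>\<^sup>c\<close> and \<open>\<psi>\<^sup>c\<close> are touched from above at
  \<open>y\<close> by translates of the same \<open>C\<^sup>1\<close> function \<open>c(x,\<cdot>)\<close>. Summing the first-order bounds along
  equidistant points of a segment, the gradients telescope and \<open>\<phi>\<^sup>c - \<psi>\<^sup>c\<close> is locally constant.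
\<close>

section \<open>The cost and its \<open>c\<close>-transforms\<close>

lemma powr_tangent_le:
  fixes a b p :: real
  assumes "p > 1" "0 \<le> a" "0 \<le> b"
  shows "a powr p + p * a powr (p - 1) * (b - a) \<le> b powr p"
proof (cases "a = 0")
  case True then show ?thesis using assms by simp
next
  case False
  then have a: "a > 0" using assms by simp
  \<comment> \<open>For positive \<open>a\<close> and \<open>b\<close> the mean value theorem gives
    a slope at some \<open>z\<close> between them, and monotonicity of \<open>t powr (p - 1)\<close>
    compares it with the slope at \<open>a\<close>. The value 0 is treated apart because
    \<open>D\<close> covers only positive points.\<close>
  have *: "a powr p - b powr p \<le> p * a powr (p - 1) * (a - b)"
  proof (cases "b = 0")
    case True
    have "a powr p = a powr (p - 1) * a" using a by (simp add: powr_diff)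
    then have "p * a powr (p-1) * (a - b) = p * a powr p" using True by simp
    then show ?thesis using True assms(1)
      mult_right_mono[of 1 p "a powr p"] by (simp add: mult.assoc)
  next
    case False
    then have b: "b > 0" using assms by simp
    have D: "((\<lambda>t. t powr p) has_real_derivative p * x powr (p - 1)) (at x)" if "x > 0" for x
      using that by (auto intro!: derivative_eq_intros)
    consider "a < b" | "a = b" | "b < a" by linarith
    then show ?thesis
    proof cases
      case 1
      obtain z where z: "a < z" "z < b" "b powr p - a powr p = (b - a) * (p * z powr (p-1))"
        using MVT2[OF 1, of "\<lambda>t. t powr p" "\<lambda>x. p * x powr (p - 1)"] D a by auto
      have "a powr (p-1) \<le> z powr (p-1)" using z a assms by (intro powr_mono2) auto
      then have "(b - a) * (p * a powr (p-1)) \<le> (b - a) * (p * z powr (p-1))"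
        using 1 assms by (intro mult_left_mono) auto
      then show ?thesis using z(3) by (simp add: algebra_simps)
    next
      case 3
      obtain z where z: "b < z" "z < a" "a powr p - b powr p = (a - b) * (p * z powr (p-1))"
        using MVT2[OF 3, of "\<lambda>t. t powr p" "\<lambda>x. p * x powr (p - 1)"] D b by auto
      have "z powr (p-1) \<le> a powr (p-1)" using z b assms by (intro powr_mono2) auto
      then have "(a - b) * (p * z powr (p-1)) \<le> (a - b) * (p * a powr (p-1))"
        using 3 assms by (intro mult_left_mono) auto
      then show ?thesis using z(3) by (simp add: algebra_simps)
    qed simp
  qed
  then show ?thesis by (simp add: algebra_simps)
qed

text \<open>The gradient of \<open>norm z powr p\<close>. Writing the direction as
  \<open>sgn z\<close> gives the value 0 at the origin without a case distinction.\<close>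

definition norm_powr_grad :: "real \<Rightarrow> 'a::real_inner \<Rightarrow> 'a" where
  "norm_powr_grad p z = (p * norm z powr (p - 1)) *\<^sub>R sgn z"

text \<open>Cauchy-Schwarz bounds the component of \<open>w\<close> along \<open>sgn z\<close> by
  \<open>norm w\<close>; since the slope factor is nonnegative, the scalar inequality applies to the
  two norms.\<close>

lemma norm_powr_tangent_le:
  fixes z w :: "'a::real_inner"
  assumes "p > 1"
  shows "norm z powr p + norm_powr_grad p z \<bullet> (w - z) \<le> norm w powr p"
proof -
  have 1: "sgn z \<bullet> z = norm z"
    by (cases "z = 0") (auto simp: sgn_div_norm dot_square_norm power2_eq_square)
  have 2: "sgn z \<bullet> w \<le> norm w"
  proof -
    have "sgn z \<bullet> w \<le> norm (sgn z) * norm w" by (rule norm_cauchy_schwarz)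
    also have "\<dots> \<le> norm w" by (simp add: norm_sgn)
    finally show ?thesis .
  qed
  have "norm_powr_grad p z \<bullet> (w - z) = p * norm z powr (p-1) * (sgn z \<bullet> w - norm z)"
    by (simp add: norm_powr_grad_def inner_diff_right 1 algebra_simps)
  also have "\<dots> \<le> p * norm z powr (p-1) * (norm w - norm z)"
    using 2 assms by (intro mult_left_mono) auto
  finally show ?thesis using powr_tangent_le[OF assms, of "norm z" "norm w"] by simp
qed

text \<open>The direction \<open>sgn z\<close> jumps at the origin, but its factor
  \<open>norm z powr (p - 1)\<close> tends to 0 there because \<open>p > 1\<close>.\<close>

lemma continuous_on_norm_powr_grad:
  assumes "p > 1"
  shows "continuous_on UNIV (norm_powr_grad p :: 'a::real_inner \<Rightarrow> 'a)"
proof -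
  have "isCont (norm_powr_grad p) z" for z :: 'a
  proof (cases "z = 0")
    case True
    have "((\<lambda>x::'a. p * norm x powr (p - 1)) \<longlongrightarrow> p * norm (0::'a) powr (p-1)) (at 0)"
      using assms by (intro tendsto_intros) auto
    then have "((\<lambda>x::'a. p * norm x powr (p - 1)) \<longlongrightarrow> 0) (at 0)" by simp
    moreover have "\<forall>\<^sub>F x::'a in at 0. norm (norm_powr_grad p x) \<le> p * norm x powr (p - 1)"
      using assms by (intro always_eventually) (auto simp: norm_powr_grad_def norm_sgn)
    ultimately have "(norm_powr_grad p \<longlongrightarrow> (0::'a)) (at 0)" by (rule Lim_null_comparison[rotated])
    then show ?thesis using True by (simp add: isCont_def norm_powr_grad_def)
  next
    case False
    then show ?thesis unfolding norm_powr_grad_def sgn_div_norm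
      by (intro continuous_intros) auto
  qed
  then show ?thesis by (simp add: continuous_on_eq_continuous_at)
qed

text \<open>The tangent inequality based at \<open>y'\<close> bounds the increment by the gradient
  at \<open>y'\<close>. The gradient is uniformly continuous on the compact set of differences
  \<open>y - x\<close>, so it may be replaced by the gradient at \<open>y\<close> with an error that
  is uniform in \<open>x\<close>.\<close>

lemma dist_powr_uniform_first_order:
  fixes \<Omega> :: "'a::euclidean_space set"
  assumes "compact \<Omega>" "p > 1" "e > 0"
  shows "\<exists>\<delta>>0. \<forall>x\<in>\<Omega>. \<forall>y\<in>\<Omega>. \<forall>y'\<in>\<Omega>. dist y y' < \<delta> \<longrightarrow>
     dist x y' powr p - dist x y powr p \<le> norm_powr_grad p (y - x) \<bullet> (y' - y) + e * dist y y'"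
proof -
  let ?K = "(\<lambda>(x,y). y - x) ` (\<Omega> \<times> \<Omega>)"
  have "compact ?K"
    unfolding case_prod_beta
    by (intro compact_continuous_image continuous_intros compact_Times assms)
  then have "uniformly_continuous_on ?K (norm_powr_grad p)"
    by (intro compact_uniformly_continuous continuous_on_subset[OF continuous_on_norm_powr_grad[OF assms(2)]]) auto
  then obtain \<delta> where \<delta>: "\<delta> > 0" "\<And>z w. z \<in> ?K \<Longrightarrow> w \<in> ?K \<Longrightarrow> dist w z < \<delta> \<Longrightarrow> dist (norm_powr_grad p w) (norm_powr_grad p z) < e"
    using assms(3) unfolding uniformly_continuous_on_def by metis
  have "dist x y' powr p - dist x y powr p \<le> norm_powr_grad p (y - x) \<bullet> (y' - y) + e * dist y y'"
    if "x \<in> \<Omega>" "y \<in> \<Omega>" "y' \<in> \<Omega>" "dist y y' < \<delta>" for x y y'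
  proof -
    have *: "dist (norm_powr_grad p (y' - x)) (norm_powr_grad p (y - x)) < e"
      using that by (intro \<delta>(2)) (auto simp: dist_norm norm_minus_commute)
    have "norm (y' - x) powr p + norm_powr_grad p (y' - x) \<bullet> ((y - x) - (y' - x)) \<le> norm (y - x) powr p"
      by (rule norm_powr_tangent_le[OF assms(2)])
    then have "dist x y' powr p - dist x y powr p \<le> norm_powr_grad p (y' - x) \<bullet> (y' - y)"
      by (simp add: dist_norm norm_minus_commute inner_diff_right)
    also have "\<dots> = norm_powr_grad p (y - x) \<bullet> (y' - y) + (norm_powr_grad p (y' - x) - norm_powr_grad p (y - x)) \<bullet> (y' - y)"
      by (simp add: inner_diff_left)
    also have "(norm_powr_grad p (y' - x) - norm_powr_grad p (y - x)) \<bullet> (y' - y)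
        \<le> norm (norm_powr_grad p (y' - x) - norm_powr_grad p (y - x)) * norm (y' - y)"
      by (rule norm_cauchy_schwarz)
    also have "\<dots> \<le> e * norm (y' - y)"
      using * by (intro mult_right_mono) (auto simp: dist_norm)
    finally show ?thesis by (simp add: dist_norm norm_minus_commute)
  qed
  then show ?thesis using \<delta>(1) by blast
qed

text \<open>All steps share the vector \<open>h\<close>, so the sum of the gradient differences
  collapses to the two endpoints. No continuity of \<open>d\<close> enters; the surviving term is
  small as soon as \<open>h\<close> is.\<close>

lemma telescoping_gradient_bound:
  fixes H :: "'b \<Rightarrow> real" and d :: "'b \<Rightarrow> 'a::real_inner"
  assumes "\<And>i. i < n \<Longrightarrow> H (y (Suc i)) - H (y i) \<le> (d (y i) - d (y (Suc i))) \<bullet> h + e"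
  shows "H (y n) - H (y 0) \<le> (d (y 0) - d (y n)) \<bullet> h + real n * e"
  using assms
proof (induction n)
  case (Suc n)
  then have "H (y n) - H (y 0) \<le> (d (y 0) - d (y n)) \<bullet> h + real n * e" by simp
  moreover have "H (y (Suc n)) - H (y n) \<le> (d (y n) - d (y (Suc n))) \<bullet> h + e" using Suc by simp
  ultimately show ?case by (simp add: algebra_simps inner_diff_left)
qed simp

section \<open>Continuity and duality of the c-transform over a compact set\<close>

locale power_cost =
  fixes \<Omega> :: "'a::euclidean_space set" and p :: real
  assumes compact_\<Omega>: "compact \<Omega>" and \<Omega>_nonempty: "\<Omega> \<noteq> {}" and p_gt_1: "p > 1"
begin

abbreviation c :: "'a \<Rightarrow> 'a \<Rightarrow> real" where "c x y \<equiv> dist x y powr p"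
abbreviation ct :: "('a \<Rightarrow> real) \<Rightarrow> 'a \<Rightarrow> real" where "ct \<equiv> ctrans \<Omega> p"

lemma continuous_on_cost: "continuous_on UNIV (\<lambda>z::'a\<times>'a. c (fst z) (snd z))"
  using p_gt_1 by (intro continuous_intros continuous_on_powr') auto

lemma cost_measurable[measurable]: "(\<lambda>z::'a\<times>'a. c (fst z) (snd z)) \<in> borel_measurable (borel \<Otimes>\<^sub>M borel)"
  using borel_measurable_continuous_onI[OF continuous_on_cost] by (simp add: borel_prod)

lemma cost_uniform:
  assumes "e > 0"
  obtains d where "d > 0" "\<And>x y y'. x \<in> \<Omega> \<Longrightarrow> y \<in> \<Omega> \<Longrightarrow> y' \<in> \<Omega> \<Longrightarrow> dist y y' < d \<Longrightarrow> \<bar>c x y - c x y'\<bar> < e"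
proof -
  have "uniformly_continuous_on (\<Omega> \<times> \<Omega>) (\<lambda>z. c (fst z) (snd z))"
    by (intro compact_uniformly_continuous compact_Times compact_\<Omega> continuous_on_subset[OF continuous_on_cost]) auto
  then obtain d where d: "d > 0" "\<forall>z\<in>\<Omega>\<times>\<Omega>. \<forall>z'\<in>\<Omega>\<times>\<Omega>. dist z' z < d \<longrightarrow> dist (c (fst z') (snd z')) (c (fst z) (snd z)) < e"
    using assms unfolding uniformly_continuous_on_def by meson
  have "\<bar>c x y - c x y'\<bar> < e" if "x \<in> \<Omega>" "y \<in> \<Omega>" "y' \<in> \<Omega>" "dist y y' < d" for x y y'
    using d(2)[rule_format, of "(x,y')" "(x,y)"] that by (simp add: dist_Pair_Pair dist_real_def)
  with d(1) show thesis by (rule that)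
qed

text \<open>An infimum of reals is informative only over a set bounded below; the cost is
  nonnegative, so an upper bound for \<open>a\<close> suffices.\<close>

lemma bdd_below_cost: "bdd_above (a ` A) \<Longrightarrow> bdd_below ((\<lambda>x. c x y - a x) ` A)"
proof -
  assume "bdd_above (a ` A)"
  then obtain M where "\<And>x. x \<in> A \<Longrightarrow> a x \<le> M" by (auto simp: bdd_above_def)
  then have "\<And>x. x \<in> A \<Longrightarrow> - M \<le> c x y - a x" by (smt (verit) powr_ge_zero)
  then show ?thesis by (rule bdd_belowI2)
qed

text \<open>The cost has a modulus of continuity in \<open>y\<close> common to all \<open>x\<close>,
  and an infimum inherits a common modulus. The set \<open>A\<close> may be smaller than
  \<open>\<Omega>\<close>, since later the infimum is taken over a subset of full measure.\<close>

lemma continuous_on_inf_cost: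
  assumes A: "A \<subseteq> \<Omega>" "A \<noteq> {}" and b: "bdd_above (a ` A)"
  shows "continuous_on \<Omega> (\<lambda>y. INF x\<in>A. c x y - a x)"
proof -
  let ?G = "\<lambda>y. INF x\<in>A. c x y - a x"
  show ?thesis
    unfolding continuous_on_iff
  proof (intro ballI allI impI)
    fix y and e :: real assume y: "y \<in> \<Omega>" "e > 0"
    obtain d where d: "d > 0" "\<And>x y y'. x \<in> \<Omega> \<Longrightarrow> y \<in> \<Omega> \<Longrightarrow> y' \<in> \<Omega> \<Longrightarrow> dist y y' < d \<Longrightarrow> \<bar>c x y - c x y'\<bar> < e/2"
      using cost_uniform[of "e/2"] y by auto
    have *: "?G y1 \<le> ?G y2 + e/2" if "y1 \<in> \<Omega>" "y2 \<in> \<Omega>" "dist y1 y2 < d" for y1 y2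
    proof -
      have "?G y1 - e/2 \<le> ?G y2"
      proof (rule cINF_greatest[OF A(2)])
        fix x assume x: "x \<in> A"
        have "?G y1 \<le> c x y1 - a x" by (rule cINF_lower[OF bdd_below_cost[OF b] x])
        moreover have "\<bar>c x y1 - c x y2\<bar> < e/2" using d(2) that x A by blast
        ultimately show "?G y1 - e/2 \<le> c x y2 - a x" by linarith
      qed
      then show ?thesis by simp
    qed
    show "\<exists>d>0. \<forall>y'\<in>\<Omega>. dist y' y < d \<longrightarrow> dist (?G y') (?G y) < e"
    proof (intro exI[of _ d] conjI ballI impI d(1))
      fix y' assume "y' \<in> \<Omega>" "dist y' y < d"
      then have "?G y \<le> ?G y' + e/2" "?G y' \<le> ?G y + e/2" using y *[of y y'] *[of y' y] by (auto simp: dist_commute[of y y'])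
      then show "dist (?G y') (?G y) < e" using y unfolding dist_real_def by linarith
    qed
  qed
qed

lemma bdd_above_continuous: "continuous_on \<Omega> h \<Longrightarrow> bdd_above ((h::'a\<Rightarrow>real) ` \<Omega>)"
  by (intro bounded_imp_bdd_above compact_imp_bounded compact_continuous_image compact_\<Omega>)

lemma continuous_on_ctrans: "bdd_above (a ` \<Omega>) \<Longrightarrow> continuous_on \<Omega> (ct a)"
  unfolding ctrans_def by (rule continuous_on_inf_cost) (auto simp: \<Omega>_nonempty)

lemma ctrans_le: "bdd_above (a ` \<Omega>) \<Longrightarrow> x \<in> \<Omega> \<Longrightarrow> ct a y \<le> c x y - a x"
  unfolding ctrans_def by (rule cINF_lower[OF bdd_below_cost])

lemma ctrans_greatest: "(\<And>x. x \<in> \<Omega> \<Longrightarrow> m \<le> c x y - a x) \<Longrightarrow> m \<le> ct a y"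
  unfolding ctrans_def by (rule cINF_greatest[OF \<Omega>_nonempty])

lemma ctrans_attained:
  assumes "continuous_on \<Omega> a"
  obtains x where "x \<in> \<Omega>" "ct a y = c x y - a x"
proof -
  have "continuous_on \<Omega> (\<lambda>x. c x y - a x)"
    using p_gt_1 by (intro continuous_intros assms continuous_on_powr') auto
  then obtain x where x: "x \<in> \<Omega>" "\<forall>x'\<in>\<Omega>. c x y - a x \<le> c x' y - a x'"
    using continuous_attains_inf[OF compact_\<Omega> \<Omega>_nonempty] by blast
  have "c x y - a x \<le> ct a y" by (rule ctrans_greatest) (use x in auto)
  moreover have "ct a y \<le> c x y - a x" by (rule ctrans_le[OF bdd_above_continuous[OF assms] x(1)])
  ultimately show thesis using x(1) that by force
qed

lemma le_ctrans_ctrans: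
  assumes "bdd_above (a ` \<Omega>)" "x \<in> \<Omega>"
  shows "a x \<le> ct (ct a) x"
proof (rule ctrans_greatest)
  fix y assume "y \<in> \<Omega>"
  have "ct a y \<le> c x y - a x" by (rule ctrans_le[OF assms])
  then show "a x \<le> c y x - ct a y" by (simp add: dist_commute)
qed

lemma ctrans_antimono:
  assumes "bdd_above (b ` \<Omega>)" "\<And>x. x \<in> \<Omega> \<Longrightarrow> a x \<le> b x"
  shows "ct b y \<le> ct a y"
proof (rule ctrans_greatest)
  fix x assume "x \<in> \<Omega>"
  then show "ct b y \<le> c x y - a x" using ctrans_le[OF assms(1), of x y] assms(2)[of x] by linarith
qed

lemma c_concave_ctrans: "bdd_above (a ` \<Omega>) \<Longrightarrow> c_concave \<Omega> p (ct a)"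
  unfolding c_concave_def by (intro exI[of _ a]) (simp add: bdd_below_cost)

text \<open>Turns the boundedness condition of \<open>c_concave\<close> into an upper bound for the
  generating function: at one fixed \<open>y\<close> the cost is bounded on \<open>\<Omega>\<close>,
  so a lower bound for cost minus \<open>a\<close> bounds \<open>a\<close> from above.\<close>

lemma c_concaveE:
  assumes "c_concave \<Omega> p g"
  obtains a where "bdd_above (a ` \<Omega>)" "\<And>y. y \<in> \<Omega> \<Longrightarrow> g y = ct a y"
proof -
  obtain a where a: "\<forall>y\<in>\<Omega>. bdd_below ((\<lambda>x. c x y - a x) ` \<Omega>)" "\<forall>y\<in>\<Omega>. g y = ct a y"
    using assms unfolding c_concave_def by blast
  obtain y where y: "y \<in> \<Omega>" using \<Omega>_nonempty by blast
  obtain m where m: "\<And>x. x \<in> \<Omega> \<Longrightarrow> m \<le> c x y - a x"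
    using a(1) y by (force simp: bdd_below_def)
  have "continuous_on \<Omega> (\<lambda>x. c x y)"
    using p_gt_1 by (intro continuous_intros continuous_on_powr') auto
  then obtain M where M: "\<And>x. x \<in> \<Omega> \<Longrightarrow> c x y \<le> M"
    using bdd_above_continuous[of "\<lambda>x. c x y"] by (auto simp: bdd_above_def)
  have "bdd_above (a ` \<Omega>)"
    by (rule bdd_aboveI2[where M="M - m"]) (use m M in force)
  then show thesis using a(2) that by blast
qed

lemma c_concave_continuous: "c_concave \<Omega> p g \<Longrightarrow> continuous_on \<Omega> g"
proof -
  assume "c_concave \<Omega> p g"
  then obtain a where a: "bdd_above (a ` \<Omega>)" "\<And>y. y \<in> \<Omega> \<Longrightarrow> g y = ct a y" by (rule c_concaveE) blast
  show ?thesis by (rule continuous_on_eq[OF continuous_on_ctrans[OF a(1)]]) (simp add: a(2))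
qed

lemma ctrans_cong: "(\<And>x. x \<in> \<Omega> \<Longrightarrow> a x = b x) \<Longrightarrow> ct a = ct b"
  unfolding ctrans_def by (auto intro!: ext arg_cong[where f=Inf] image_cong)

text \<open>The transform reverses order and its square lies above the identity, so three transforms
  equal one, as for any Galois connection.\<close>

lemma c_concave_ctrans_ctrans:
  assumes "c_concave \<Omega> p g" "x \<in> \<Omega>"
  shows "ct (ct g) x = g x"
proof -
  obtain a where a: "bdd_above (a ` \<Omega>)" "\<And>y. y \<in> \<Omega> \<Longrightarrow> g y = ct a y"
    by (rule c_concaveE[OF assms(1)]) blast
  have g: "ct g = ct (ct a)" by (rule ctrans_cong) (rule a(2))
  have b: "bdd_above (ct a ` \<Omega>)" by (rule bdd_above_continuous[OF continuous_on_ctrans[OF a(1)]])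
  have b': "bdd_above (ct (ct a) ` \<Omega>)" by (rule bdd_above_continuous[OF continuous_on_ctrans[OF b]])
  have "ct (ct (ct a)) x \<le> ct a x"
    by (rule ctrans_antimono[OF b']) (rule le_ctrans_ctrans[OF a(1)])
  moreover have "ct a x \<le> ct (ct (ct a)) x" by (rule le_ctrans_ctrans[OF b assms(2)])
  ultimately show ?thesis using g a(2)[OF assms(2)] by simp
qed

text \<open>At every \<open>y\<close> both transforms are touched from above by vertical translates
  of the same function \<open>c (X y)\<close>. Along equidistant points each step of the difference
  is bounded by a difference of consecutive cost gradients, and these telescope. The selection
  \<open>X\<close> may be arbitrary, as regularity is asked only of the cost.\<close>

lemma ctrans_diff_le_on_segment:
  assumes \<phi>: "continuous_on \<Omega> \<phi>" and \<psi>: "continuous_on \<Omega> \<psi>"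
    and contact: "\<And>y. y \<in> \<Omega> \<Longrightarrow> X y \<in> \<Omega> \<and> ct \<phi> y = c (X y) y - \<phi> (X y) \<and> ct \<psi> y = c (X y) y - \<psi> (X y)"
    and seg: "closed_segment a b \<subseteq> \<Omega>"
  shows "ct \<phi> b - ct \<psi> b \<le> ct \<phi> a - ct \<psi> a"
proof (rule field_le_epsilon)
  fix \<eta> :: real assume \<eta>: "\<eta> > 0"
  define L where "L = norm (b - a)"
  define H where "H y = ct \<phi> y - ct \<psi> y" for y
  define d where "d y = norm_powr_grad p (y - X y)" for y
  \<comment> \<open>Chosen so that the accumulated first-order errors \<open>2 * e * L\<close> stay
    below half of \<open>\<eta>\<close>; the 1 added to \<open>L\<close> covers the degenerate
    segment \<open>a = b\<close>.\<close>
  define e where "e = \<eta> / (4 * (L + 1))"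
  have L: "L \<ge> 0" by (simp add: L_def)
  have e: "e > 0" using \<eta> L by (simp add: e_def)
  have eL: "2 * e * L \<le> \<eta>/2"
  proof -
    have "2 * e * L = (\<eta>/2) * (L / (L+1))" using L by (simp add: e_def field_simps)
    also have "\<dots> \<le> (\<eta>/2) * 1" using L \<eta> by (intro mult_left_mono) auto
    finally show ?thesis by simp
  qed
  obtain \<delta> where \<delta>: "\<delta> > 0" "\<And>x y y'. x \<in> \<Omega> \<Longrightarrow> y \<in> \<Omega> \<Longrightarrow> y' \<in> \<Omega> \<Longrightarrow> dist y y' < \<delta> \<Longrightarrow>
     c x y' - c x y \<le> norm_powr_grad p (y - x) \<bullet> (y' - y) + e * dist y y'"
    using dist_powr_uniform_first_order[OF compact_\<Omega> p_gt_1 e] by blast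
  \<comment> \<open>The endpoint term left by telescoping, before division by the number of steps. A
    large \<open>N\<close> makes \<open>M / N\<close> small and brings the step length below
    \<open>\<delta>\<close>.\<close>
  define M where "M = \<bar>(d a - d b) \<bullet> (b - a)\<bar>"
  obtain N :: nat where N: "N > 0" "L / real N < \<delta>" "M / real N < \<eta>/2"
  proof -
    have "((\<lambda>n. L / real n) \<longlongrightarrow> 0) sequentially" "((\<lambda>n. M / real n) \<longlongrightarrow> 0) sequentially"
      by (rule lim_const_over_n)+
    from order_tendstoD(2)[OF this(1) \<delta>(1)] order_tendstoD(2)[OF this(2), of "\<eta>/2"] \<eta>
    have "\<forall>\<^sub>F n in sequentially. L / real n < \<delta>" "\<forall>\<^sub>F n in sequentially. M / real n < \<eta>/2"
      by simp_all
    then have "\<forall>\<^sub>F n in sequentially. n > 0 \<and> L / real n < \<delta> \<and> M / real n < \<eta>/2"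
      using eventually_gt_at_top[of 0] by eventually_elim auto
    then show thesis using that eventually_happens'[OF sequentially_bot] by blast
  qed
  define h where "h = (1 / real N) *\<^sub>R (b - a)"
  define y where "y i = a + real i *\<^sub>R h" for i
  have nh: "norm h = L / real N" using N by (simp add: h_def L_def)
  have y0: "y 0 = a" by (simp add: y_def)
  have yN: "y N = b" using N by (simp add: y_def h_def)
  have yin: "y i \<in> \<Omega>" if "i \<le> N" for i
  proof -
    have "y i = (1 - real i / real N) *\<^sub>R a + (real i / real N) *\<^sub>R b"
      by (simp add: y_def h_def algebra_simps)
    moreover have "0 \<le> real i / real N" "real i / real N \<le> 1" using that N by auto
    ultimately have "y i \<in> closed_segment a b" by (auto simp: closed_segment_def)
    then show ?thesis using seg by blast
  qed
  have step: "H (y (Suc i)) - H (y i) \<le> (d (y i) - d (y (Suc i))) \<bullet> h + 2 * e * norm h" if "i < N" for i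
  proof -
    define s t where "s = y i" and "t = y (Suc i)"
    have st: "s \<in> \<Omega>" "t \<in> \<Omega>" using yin that by (auto simp: s_def t_def)
    have ts: "t - s = h" by (simp add: s_def t_def y_def algebra_simps)
    have ds: "dist s t = norm h" "dist t s = norm h" using ts by (auto simp: dist_norm norm_minus_commute)
    have st': "s - t = - h" using ts by (metis minus_diff_eq)
    have X: "X s \<in> \<Omega>" "X t \<in> \<Omega>" using contact st by auto
    \<comment> \<open>The contact point of \<open>s\<close> is a competitor for
      \<open>\<phi>\<close> at \<open>t\<close>, and the contact point of \<open>t\<close> is one
      for \<open>\<psi>\<close> at \<open>s\<close>. This gives the gradients at \<open>s\<close>
      and \<open>t\<close> opposite signs.\<close>
    have "ct \<phi> t \<le> c (X s) t - \<phi> (X s)" by (rule ctrans_le[OF bdd_above_continuous[OF \<phi>] X(1)])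
    then have 1: "ct \<phi> t - ct \<phi> s \<le> c (X s) t - c (X s) s" using contact[OF st(1)] by linarith
    have "ct \<psi> s \<le> c (X t) s - \<psi> (X t)" by (rule ctrans_le[OF bdd_above_continuous[OF \<psi>] X(2)])
    then have 2: "ct \<psi> s - ct \<psi> t \<le> c (X t) s - c (X t) t" using contact[OF st(2)] by linarith
    have 3: "c (X s) t - c (X s) s \<le> d s \<bullet> h + e * norm h"
      using \<delta>(2)[OF X(1) st] ds nh N by (simp add: ts d_def)
    have 4: "c (X t) s - c (X t) t \<le> - (d t \<bullet> h) + e * norm h"
      using \<delta>(2)[OF X(2) st(2) st(1)] ds nh N by (simp add: st' d_def)
    show ?thesis using 1 2 3 4 unfolding s_def[symmetric] t_def[symmetric] H_def by (simp add: inner_diff_left)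
  qed
  have "H b - H a \<le> (d a - d b) \<bullet> h + real N * (2 * e * norm h)"
    using telescoping_gradient_bound[of N H y d h "2 * e * norm h"] step y0 yN by simp
  also have "real N * (2 * e * norm h) = 2 * e * L" using N by (simp add: nh)
  also have "(d a - d b) \<bullet> h \<le> M / real N" using N by (simp add: h_def M_def divide_right_mono)
  finally show "ct \<phi> b - ct \<psi> b \<le> ct \<phi> a - ct \<psi> a + \<eta>" using eL N unfolding H_def by linarith
qed

text \<open>Applying the segment bound in both directions makes the difference constant on balls
  inside \<open>U\<close>, where segments are available. Connectedness extends this to
  \<open>U\<close> and continuity to its closure.\<close>

lemma ctrans_diff_constant:
  assumes \<phi>: "continuous_on \<Omega> \<phi>" and \<psi>: "continuous_on \<Omega> \<psi>"
    and contact: "\<And>y. y \<in> \<Omega> \<Longrightarrow> \<exists>x\<in>\<Omega>. ct \<phi> y = c x y - \<phi> x \<and> ct \<psi> y = c x y - \<psi> x"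
    and U: "open U" "connected U" "\<Omega> = closure U"
  shows "\<exists>k. \<forall>y\<in>\<Omega>. ct \<phi> y - ct \<psi> y = k"
proof -
  define H where "H y = ct \<phi> y - ct \<psi> y" for y
  obtain X where X: "\<And>y. y \<in> \<Omega> \<Longrightarrow> X y \<in> \<Omega> \<and> ct \<phi> y = c (X y) y - \<phi> (X y) \<and> ct \<psi> y = c (X y) y - \<psi> (X y)"
    using contact by metis
  have UO: "U \<subseteq> \<Omega>" using U closure_subset by auto
  have seg: "H a = H b" if "closed_segment a b \<subseteq> \<Omega>" for a b
    using ctrans_diff_le_on_segment[OF \<phi> \<psi> X that] 
      ctrans_diff_le_on_segment[OF \<phi> \<psi> X, of b a] that
    unfolding H_def by (simp add: closed_segment_commute)
  have "H constant_on U"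
  proof (rule locally_constant_imp_constant[OF U(2)])
    fix a assume "a \<in> U"
    then obtain r where r: "r > 0" "ball a r \<subseteq> U" using U(1) open_contains_ball by blast
    have Ha: "H x = H a" if "x \<in> ball a r" for x
    proof (rule seg)
      have "closed_segment x a \<subseteq> ball a r"
        using that r by (intro closed_segment_subset) auto
      then show "closed_segment x a \<subseteq> \<Omega>" using r UO by blast
    qed
    have "openin (top_of_set U) (ball a r)"
      using r by (simp add: open_subset)
    then show "\<exists>T. openin (top_of_set U) T \<and> a \<in> T \<and> (\<forall>x\<in>T. H x = H a)"
      using centre_in_ball[of a r] r(1) Ha by blast
  qed
  then obtain k where k: "\<And>x. x \<in> U \<Longrightarrow> H x = k" unfolding constant_on_def by blast
  have "continuous_on (closure U) H" unfolding H_def U(3)[symmetric]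
    by (intro continuous_intros continuous_on_ctrans bdd_above_continuous \<phi> \<psi>)
  then have "H y = k" if "y \<in> \<Omega>" for y
    by (rule continuous_constant_on_closure) (use k that U(3) in auto)
  then show ?thesis unfolding H_def by blast
qed

end

section \<open>The internal energy\<close>

text \<open>For \<open>a > 0\<close> this is the tangent line below a convex function. At the
  endpoint 0, which is not interior, it reads \<open>0 \<le> f b\<close> because \<open>f\<close>
  and \<open>f'\<close> vanish there.\<close>

lemma standing_f_tangent:
  assumes f: "standing_f f f'" and "0 \<le> a" "0 \<le> b"
  shows "f a + f' a * (b - a) \<le> f b"
proof (cases "a = 0")
  case True
  then show ?thesis using assms by (simp add: standing_f_def)
next
  case False
  have cv: "convex_on {0..} f"
  proof (rule convex_onI)
    fix t x y :: real assume t: "0 < t" "t < 1" and xy: "x \<in> {0..}" "y \<in> {0..}"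
    show "f ((1 - t) *\<^sub>R x + t *\<^sub>R y) \<le> (1 - t) * f x + t * f y"
    proof (cases "x = y")
      case True then show ?thesis by (simp add: algebra_simps)
    next
      case False
      have "f ((1 - t) * x + (1 - (1 - t)) * y) < (1 - t) * f x + (1 - (1 - t)) * f y"
        using f t xy False unfolding standing_f_def strictly_convex_on_def
        by (metis diff_gt_0_iff_gt diff_less_eq less_add_same_cancel1)
      then show ?thesis by simp
    qed
  qed (simp)
  have "f b - f a \<ge> f' a * (b - a)"
    using False assms by (intro convex_on_imp_above_tangent[OF cv]) (auto simp: standing_f_def)
  then show ?thesis by simp
qed

text \<open>The tangent at \<open>a\<close>, evaluated at 0, gives
  \<open>0 \<le> f a \<le> f' a * a\<close>.\<close>

lemma standing_f_deriv_nonneg: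
  assumes f: "standing_f f f'" and "0 \<le> a"
  shows "0 \<le> f' a"
proof (cases "a = 0")
  case True then show ?thesis using f by (simp add: standing_f_def)
next
  case False
  have "f a + f' a * (0 - a) \<le> f 0" using standing_f_tangent[OF f] assms by blast
  then have "f a \<le> f' a * a" using f by (simp add: standing_f_def)
  moreover have "0 \<le> f a" using f assms by (simp add: standing_f_def)
  ultimately show ?thesis using False assms by (smt (verit) mult_neg_pos)
qed

lemma standing_f_mono:
  assumes f: "standing_f f f'" and "0 \<le> a" "a \<le> b"
  shows "f a \<le> f b"
  using standing_f_tangent[OF f, of a b] mult_nonneg_nonneg[OF standing_f_deriv_nonneg[OF f, of a], of "b - a"] assms
  by linarith

lemma standing_f_convex:
  assumes f: "standing_f f f'" and "0 \<le> a" "0 \<le> b" "0 \<le> t" "t \<le> 1"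
  shows "f ((1 - t) * a + t * b) \<le> (1 - t) * f a + t * f b"
proof -
  define m where "m = (1 - t) * a + t * b"
  have m: "0 \<le> m" using assms by (simp add: m_def)
  have 1: "f m + f' m * (a - m) \<le> f a" "f m + f' m * (b - m) \<le> f b"
    using standing_f_tangent[OF f m] assms by auto
  have "(1 - t) * (f m + f' m * (a - m)) + t * (f m + f' m * (b - m)) \<le> (1 - t) * f a + t * f b"
    using assms 1 by (intro add_mono mult_left_mono) auto
  also have "(1 - t) * (f m + f' m * (a - m)) + t * (f m + f' m * (b - m))
      = f m + f' m * ((1 - t) * a + t * b - m)" by (simp add: algebra_simps)
  finally show ?thesis by (simp add: m_def)
qed

text \<open>Equal slopes at \<open>a < b\<close> would, by the tangents at both points, put
  \<open>f\<close> at the midpoint on or above the chord, against strict convexity. Injectivity is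
  what lets \<open>the_inv_into\<close> recover \<open>u\<close> from
  \<open>f' (u x)\<close>.\<close>

lemma standing_f_inj:
  assumes f: "standing_f f f'"
  shows "inj_on f' {0..}"
proof -
  have "f' a \<noteq> f' b" if ab: "0 \<le> a" "a < b" for a b
  proof
    assume eq: "f' a = f' b"
    define m where "m = (1/2) * a + (1 - 1/2) * b"
    have sc: "f m < (1/2) * f a + (1 - 1/2) * f b"
      using f ab unfolding standing_f_def strictly_convex_on_def m_def
      by (smt (verit) atLeast_iff divide_less_eq_1_pos half_gt_zero_iff)
    have "0 \<le> m" "0 \<le> b" using ab by (simp_all add: m_def)
    then have t: "f b + f' b * (a - b) \<le> f a" "f a + f' a * (m - a) \<le> f m"
      using standing_f_tangent[OF f] ab(1) by blast+
    have "f' a * (m - a) = f' b * (b - a) / 2" by (simp add: eq m_def field_simps)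
    moreover have "f' b * (a - b) = - (f' b * (b - a))" by (simp add: algebra_simps)
    ultimately show False using sc t by simp
  qed
  then show ?thesis by (metis atLeast_iff inj_onI linorder_neqE_linordered_idom)
qed

text \<open>Precomposing with \<open>max 0\<close> extends \<open>h\<close> continuously to the
  whole line without changing it at the values of \<open>u\<close>.\<close>

lemma borel_measurable_compose_nonneg:
  fixes h :: "real \<Rightarrow> real"
  assumes "continuous_on {0..} h" and [measurable]: "u \<in> borel_measurable M" and "\<And>x. 0 \<le> u x"
  shows "(\<lambda>x. h (u x)) \<in> borel_measurable M"
proof -
  have "continuous_on UNIV (\<lambda>t. h (max 0 t))"
    by (intro continuous_on_compose2[OF assms(1)] continuous_intros) auto
  then have [measurable]: "(\<lambda>t. h (max 0 t)) \<in> borel_measurable borel"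
    by (rule borel_measurable_continuous_onI)
  have "(\<lambda>x. h (max 0 (u x))) \<in> borel_measurable M" by measurable
  then show ?thesis using assms(3) by (simp add: max_absorb2)
qed

lemma standing_f_continuous:
  assumes "standing_f f f'" shows "continuous_on {0..} f"
  using assms unfolding standing_f_def
  by (intro DERIV_continuous_on[of _ f f']) auto

section \<open>Mixtures of plans and the first variation\<close>

text \<open>The convex combination is obtained by a Bernoulli choice between the two measures, so
  its properties follow from those of \<open>bind\<close>.\<close>

lemma mixture_measure:
  assumes M: "prob_space M" and N: "prob_space N" and S: "sets N = sets M" and e: "0 \<le> e" "e \<le> 1"
  obtains Q where "sets Q = sets M" "prob_space Q"
    "\<And>h. h \<in> borel_measurable M \<Longrightarrow> (\<integral>\<^sup>+x. h x \<partial>Q) = ennreal (1 - e) * (\<integral>\<^sup>+x. h x \<partial>M) + ennreal e * (\<integral>\<^sup>+x. h x \<partial>N)"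
proof -
  define K where "K b = (if b then N else M)" for b
  have K: "K \<in> measurable (measure_pmf (bernoulli_pmf e)) (subprob_algebra M)"
    using M N S by (auto simp: K_def space_subprob_algebra prob_space_imp_subprob_space)
  let ?Q = "measure_pmf (bernoulli_pmf e) \<bind> K"
  show thesis
  proof (rule that[of ?Q])
    show "sets ?Q = sets M"
      by (rule sets_bind) (auto simp: K_def S)
    show "prob_space ?Q"
      by (rule measure_pmf.prob_space_bind[OF _ K]) (auto simp: K_def M N)
    fix h :: "_ \<Rightarrow> ennreal" assume h: "h \<in> borel_measurable M"
    show "(\<integral>\<^sup>+x. h x \<partial>?Q) = ennreal (1 - e) * (\<integral>\<^sup>+x. h x \<partial>M) + ennreal e * (\<integral>\<^sup>+x. h x \<partial>N)"
      unfolding nn_integral_bind[OF h K] using e by (simp add: K_def mult.commute add.commute)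
  qed
qed

text \<open>A mixture of plans is a plan for the mixed first marginals. A plan for
  \<open>\<mu>\<close> that is optimal up to \<open>r\<close> is mixed with
  \<open>\<gamma>'\<close>, so no optimal plan has to exist. Only the values of
  \<open>\<mu>e\<close> on Borel sets are prescribed, which lets it be given as a density.\<close>

lemma Tp_mixture_le:
  fixes \<mu> \<mu>' \<nu> \<mu>e :: "'a::euclidean_space measure"
  assumes g': "\<gamma>' \<in> transport_plans \<mu>' \<nu>" and e: "0 \<le> e" "e \<le> 1"
    and sets_\<mu>e: "sets \<mu>e = sets borel"
    and \<mu>e: "\<And>A. A \<in> sets borel \<Longrightarrow> emeasure \<mu>e A = ennreal (1 - e) * emeasure \<mu> A + ennreal e * emeasure \<mu>' A"
    and fin: "Tp p \<mu> \<nu> < \<infinity>"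
  shows "Tp p \<mu>e \<nu> \<le> ennreal (1 - e) * Tp p \<mu> \<nu> + ennreal e * (\<integral>\<^sup>+ z. ennreal (dist (fst z) (snd z) powr p) \<partial>\<gamma>')"
proof (rule ennreal_le_epsilon)
  let ?c = "\<lambda>z::'a\<times>'a. ennreal (dist (fst z) (snd z) powr p)"
  fix r :: real assume r: "0 < r"
  have fin': "Tp p \<mu> \<nu> \<noteq> \<infinity>" using fin by simp
  obtain \<gamma> where g: "\<gamma> \<in> transport_plans \<mu> \<nu>" "(\<integral>\<^sup>+ z. ?c z \<partial>\<gamma>) \<le> Tp p \<mu> \<nu> + ennreal r"
    using INF_approx_ennreal[OF r Tp_def fin'] by (auto intro: less_imp_le)
  have G: "sets \<gamma> = sets (borel \<Otimes>\<^sub>M borel)" "prob_space \<gamma>" "distr \<gamma> borel fst = \<mu>" "distr \<gamma> borel snd = \<nu>"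
    and G': "sets \<gamma>' = sets (borel \<Otimes>\<^sub>M borel)" "prob_space \<gamma>'" "distr \<gamma>' borel fst = \<mu>'" "distr \<gamma>' borel snd = \<nu>"
    using g g' by (auto simp: transport_plans_def)
  have "sets \<gamma>' = sets \<gamma>" using G G' by simp
  then obtain Q where Q: "sets Q = sets \<gamma>" "prob_space Q"
    "\<And>h. h \<in> borel_measurable \<gamma> \<Longrightarrow> (\<integral>\<^sup>+x. h x \<partial>Q) = ennreal (1 - e) * (\<integral>\<^sup>+x. h x \<partial>\<gamma>) + ennreal e * (\<integral>\<^sup>+x. h x \<partial>\<gamma>')"
    by (rule mixture_measure[OF G(2) G'(2) _ e]) blast
  have sQ: "sets Q = sets (borel \<Otimes>\<^sub>M borel)" using Q G by simp
  have [measurable_cong]: "sets Q = sets (borel \<Otimes>\<^sub>M borel)" "sets \<gamma> = sets (borel \<Otimes>\<^sub>M borel)" "sets \<gamma>' = sets (borel \<Otimes>\<^sub>M borel)"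
    by (fact sQ G(1) G'(1))+
  have em: "emeasure (distr Q borel t) A = ennreal (1 - e) * emeasure (distr \<gamma> borel t) A + ennreal e * emeasure (distr \<gamma>' borel t) A"
    if A[measurable]: "A \<in> sets borel" and t[measurable]: "t \<in> measurable (borel \<Otimes>\<^sub>M borel) borel" for A and t :: "'a\<times>'a \<Rightarrow> 'a"
  proof -
    have *: "emeasure (distr P borel t) A = (\<integral>\<^sup>+z. indicator A (t z) \<partial>P)"
      if [measurable_cong]: "sets P = sets (borel \<Otimes>\<^sub>M borel)" for P :: "('a\<times>'a) measure"
    proof -
      have "emeasure (distr P borel t) A = (\<integral>\<^sup>+x. indicator A x \<partial>(distr P borel t))" by simp
      also have "\<dots> = (\<integral>\<^sup>+z. indicator A (t z) \<partial>P)" by (rule nn_integral_distr) measurable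
      finally show ?thesis .
    qed
    show ?thesis unfolding *[OF sQ] *[OF G(1)] *[OF G'(1)] by (rule Q(3)) measurable
  qed
  have "Q \<in> transport_plans \<mu>e \<nu>"
    unfolding transport_plans_def mem_Collect_eq
  proof (intro conjI sQ Q(2))
    show "distr Q borel fst = \<mu>e"
      by (rule measure_eqI) (auto simp: sets_\<mu>e em G G' \<mu>e)
    \<comment> \<open>Both plans have second marginal \<open>\<nu>\<close>, so mixing leaves it
      unchanged.\<close>
    have "ennreal (1 - e) * x + ennreal e * x = x" for x
      using e by (simp add: distrib_right[symmetric] flip: ennreal_plus)
    then show "distr Q borel snd = \<nu>"
      using G'(4) G(4) by (intro measure_eqI) (auto simp: em)
  qed
  then have "Tp p \<mu>e \<nu> \<le> (\<integral>\<^sup>+ z. ?c z \<partial>Q)" unfolding Tp_def by (rule INF_lower)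
  also have "\<dots> = ennreal (1 - e) * (\<integral>\<^sup>+z. ?c z \<partial>\<gamma>) + ennreal e * (\<integral>\<^sup>+z. ?c z \<partial>\<gamma>')"
    by (rule Q(3)) measurable
  also have "\<dots> \<le> ennreal (1 - e) * (Tp p \<mu> \<nu> + ennreal r) + ennreal e * (\<integral>\<^sup>+z. ?c z \<partial>\<gamma>')"
    by (intro add_right_mono mult_left_mono g(2)) auto
  also have "\<dots> = ennreal (1 - e) * Tp p \<mu> \<nu> + ennreal e * (\<integral>\<^sup>+z. ?c z \<partial>\<gamma>') + ennreal (1 - e) * ennreal r"
    by (simp add: distrib_left add_ac)
  also have "ennreal (1 - e) * ennreal r \<le> ennreal r"
    using e r by (simp add: mult_left_le_one_le ennreal_leI flip: ennreal_mult)
  finally show "Tp p \<mu>e \<nu> \<le> ennreal (1 - e) * Tp p \<mu> \<nu> + ennreal e * (\<integral>\<^sup>+z. ?c z \<partial>\<gamma>') + ennreal r"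
    by (simp add: add_left_mono)
qed

text \<open>Almost every value of \<open>T\<close> lies in the support of its image measure: an open
  set with null preimage is a union of basic open sets with null preimage, and there are only
  countably many of these.\<close>

lemma AE_in_support:
  fixes T :: "'a \<Rightarrow> 'b::second_countable_topology"
  assumes [measurable]: "T \<in> borel_measurable M"
  shows "AE x in M. \<forall>V. open V \<longrightarrow> T x \<in> V \<longrightarrow> emeasure M (T -` V \<inter> space M) \<noteq> 0"
proof -
  obtain B :: "'b set set" where B: "countable B" "topological_basis B"
    using ex_countable_basis by blast
  define B0 where "B0 = {V\<in>B. emeasure M (T -` V \<inter> space M) = 0}"
  have op: "open V" if "V \<in> B" for V using B(2) that by (rule topological_basis_open)
  have "(\<Union>V\<in>B0. T -` V \<inter> space M) \<in> null_sets M"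
  proof (rule null_sets_UN')
    show "countable B0" using B(1) by (auto simp: B0_def)
    fix V assume "V \<in> B0"
    then show "T -` V \<inter> space M \<in> null_sets M"
      using op by (auto simp: B0_def null_sets_def intro!: measurable_sets[OF assms])
  qed
  then have "AE x in M. x \<notin> (\<Union>V\<in>B0. T -` V \<inter> space M)" by (rule AE_not_in)
  then show ?thesis
    using AE_space
  proof eventually_elim
    case (elim x)
    show ?case
    proof (intro allI impI notI)
      fix V assume V: "open V" "T x \<in> V" "emeasure M (T -` V \<inter> space M) = 0"
      obtain V' where V': "V' \<in> B" "T x \<in> V'" "V' \<subseteq> V" using topological_basisE[OF B(2) V(1,2)] by blast
      have "emeasure M (T -` V' \<inter> space M) \<le> emeasure M (T -` V \<inter> space M)"
        using V V' by (intro emeasure_mono measurable_sets[OF assms]) auto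
      then have "V' \<in> B0" using V V' by (simp add: B0_def)
      then show False using elim V' by auto
    qed
  qed
qed

text \<open>A density is unique almost everywhere, so all candidates in the infimum defining
  \<open>Fen\<close> have the same integral.\<close>

lemma Fen_density:
  assumes f: "standing_f f f'" and [measurable]: "\<Omega> \<in> sets borel" "u \<in> borel_measurable borel" and u: "\<forall>x. 0 \<le> u x"
  shows "Fen f \<Omega> (density lborel (\<lambda>x. ennreal (u x))) = (\<integral>\<^sup>+x\<in>\<Omega>. ennreal (f (u x)) \<partial>lborel)"
proof (rule antisym)
  show "Fen f \<Omega> (density lborel (\<lambda>x. ennreal (u x))) \<le> (\<integral>\<^sup>+x\<in>\<Omega>. ennreal (f (u x)) \<partial>lborel)"
    unfolding Fen_def by (rule INF_lower) (use u in auto)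
  show "(\<integral>\<^sup>+x\<in>\<Omega>. ennreal (f (u x)) \<partial>lborel) \<le> Fen f \<Omega> (density lborel (\<lambda>x. ennreal (u x)))"
    unfolding Fen_def
  proof (rule INF_greatest, clarify)
    fix w :: "'a \<Rightarrow> real" assume [measurable]: "w \<in> borel_measurable borel" and w: "\<forall>x. 0 \<le> w x"
      and eq: "density lborel (\<lambda>x. ennreal (u x)) = density lborel (\<lambda>x. ennreal (w x))"
    have "AE x in lborel. ennreal (u x) = ennreal (w x)"
      using eq by (subst (asm) sigma_finite_measure.density_unique_iff[OF sigma_finite_lborel]) auto
    then have "AE x in lborel. u x = w x" by eventually_elim (use u w in auto)
    then have "(\<integral>\<^sup>+x\<in>\<Omega>. ennreal (f (u x)) \<partial>lborel) = (\<integral>\<^sup>+x\<in>\<Omega>. ennreal (f (w x)) \<partial>lborel)"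
      by (intro nn_integral_cong_AE) auto
    then show "(\<integral>\<^sup>+x\<in>\<Omega>. ennreal (f (u x)) \<partial>lborel) \<le> (\<integral>\<^sup>+x\<in>\<Omega>. ennreal (f (w x)) \<partial>lborel)" by simp
  qed
qed

text \<open>One-sided chain rule along the segment from \<open>a\<close> to \<open>b\<close>. The
  segment stays in the half-line, so the derivative within \<open>{0..}\<close> is enough even at
  \<open>a = 0\<close>; the step \<open>1 / Suc n\<close> is positive and at most 1.\<close>

lemma standing_f_quotient_tendsto:
  assumes f: "standing_f f f'" and ab: "0 \<le> a" "0 \<le> b"
  shows "(\<lambda>n. (f ((1 - 1 / real (Suc n)) * a + 1 / real (Suc n) * b) - f a) * real (Suc n)) \<longlonglongrightarrow> f' a * (b - a)"
proof -
  define g where "g t = (1 - t) * a + t * b" for t :: real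
  have g01: "g ` {0..1} \<subseteq> {0..}" using ab by (auto simp: g_def)
  have "(f has_real_derivative f' (g 0)) (at (g 0) within {0..})"
    using f ab by (auto simp: standing_f_def g_def)
  then have "(f has_real_derivative f' (g 0)) (at (g 0) within g ` {0..1})"
    by (rule DERIV_subset[OF _ g01])
  moreover have "(g has_real_derivative (b - a)) (at 0 within {0..1})"
    unfolding g_def by (auto intro!: derivative_eq_intros)
  ultimately have "(f \<circ> g has_real_derivative f' (g 0) * (b - a)) (at 0 within {0..1})"
    by (rule DERIV_image_chain)
  then have lim: "((\<lambda>t. (f (g t) - f a) / t) \<longlongrightarrow> f' a * (b - a)) (at 0 within {0..1})"
    by (simp add: has_field_derivative_iff g_def)
  have "filterlim (\<lambda>n. 1 / real (Suc n)) (at 0 within {0..1}) sequentially"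
    unfolding filterlim_at
  proof
    show "\<forall>\<^sub>F n in sequentially. 1 / real (Suc n) \<in> {0..1} \<and> 1 / real (Suc n) \<noteq> 0"
      by (intro always_eventually) auto
    show "(\<lambda>n. 1 / real (Suc n)) \<longlonglongrightarrow> 0"
      using LIMSEQ_inverse_real_of_nat by (simp add: inverse_eq_divide)
  qed
  from filterlim_compose[OF lim this] show ?thesis by (simp add: g_def)
qed

lemma emeasure_density_mixture:
  fixes u w :: "'a::euclidean_space \<Rightarrow> real"
  assumes [measurable]: "u \<in> borel_measurable borel" "w \<in> borel_measurable borel"
    and "\<And>x. 0 \<le> u x" "\<And>x. 0 \<le> w x" "0 \<le> e" "e \<le> 1" and [measurable]: "A \<in> sets borel"
  shows "emeasure (density lborel (\<lambda>x. ennreal ((1 - e) * u x + e * w x))) A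
    = ennreal (1 - e) * emeasure (density lborel (\<lambda>x. ennreal (u x))) A + ennreal e * emeasure (density lborel (\<lambda>x. ennreal (w x))) A"
proof -
  have "emeasure (density lborel (\<lambda>x. ennreal ((1 - e) * u x + e * w x))) A
      = (\<integral>\<^sup>+x. ennreal (1 - e) * (ennreal (u x) * indicator A x) + ennreal e * (ennreal (w x) * indicator A x) \<partial>lborel)"
    using assms by (subst emeasure_density) (auto intro!: nn_integral_cong simp: ennreal_mult split: split_indicator)
  also have "\<dots> = ennreal (1 - e) * emeasure (density lborel (\<lambda>x. ennreal (u x))) A + ennreal e * emeasure (density lborel (\<lambda>x. ennreal (w x))) A"
    by (simp add: nn_integral_add nn_integral_cmult emeasure_density)
  finally show ?thesis .
qed

text \<open>Fatou's lemma replaces differentiation under the integral, so that \<open>f'(u) u\<close> need not be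
  known to be integrable beforehand.\<close>

lemma first_variation:
  fixes \<Omega> :: "'a::euclidean_space set" and u w :: "'a \<Rightarrow> real"
  assumes f: "standing_f f f'"
    and \<Omega>[measurable]: "\<Omega> \<in> sets borel" and \<Omega>fin: "emeasure lborel \<Omega> < \<infinity>"
    and u_meas[measurable]: "u \<in> borel_measurable borel" and u: "\<forall>x. 0 \<le> u x"
    and \<mu>_def: "\<mu> = density lborel (\<lambda>x. ennreal (u x))"
    and \<mu>: "\<mu> \<in> prob_on \<Omega>"
    and min: "\<forall>\<mu>'\<in>prob_on \<Omega>. Ffun p f \<Omega> \<nu> \<mu> \<le> Ffun p f \<Omega> \<nu> \<mu>'"
    and w_meas[measurable]: "w \<in> borel_measurable borel" and w: "\<And>x. 0 \<le> w x" "\<And>x. w x \<le> K" "\<And>x. x \<notin> \<Omega> \<Longrightarrow> w x = 0"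
    and g': "\<gamma>' \<in> transport_plans (density lborel (\<lambda>x. ennreal (w x))) \<nu>"
  shows "(\<integral>\<^sup>+x\<in>\<Omega>. ennreal (f' (u x) * u x) \<partial>lborel) + Tp p \<mu> \<nu>
    \<le> (\<integral>\<^sup>+x\<in>\<Omega>. ennreal (f' (u x) * w x) \<partial>lborel) + (\<integral>\<^sup>+ z. ennreal (dist (fst z) (snd z) powr p) \<partial>\<gamma>')"
    (is "_ \<le> _ + ?C")
proof (cases "?C < \<infinity>")
  case False
  then show ?thesis by (simp add: not_less top_unique)
next
  case Cfin: True
  define \<mu>' where "\<mu>' = density lborel (\<lambda>x. ennreal (w x))"
  have \<mu>': "prob_space \<mu>'"
  proof -
    have G': "sets \<gamma>' = sets (borel \<Otimes>\<^sub>M borel)" "prob_space \<gamma>'" "distr \<gamma>' borel fst = \<mu>'"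
      using g' by (auto simp: transport_plans_def \<mu>'_def)
    have "fst \<in> measurable \<gamma>' borel"
      by (subst measurable_cong_sets[OF G'(1) refl]) simp
    then show ?thesis using prob_space.prob_space_distr[OF G'(2)] G'(3) by metis
  qed
  \<comment> \<open>Lebesgue measure concentrated on \<open>\<Omega>\<close> but kept on the whole
    space. It is finite, so constants are integrable.\<close>
  define L where "L = density lborel (indicator \<Omega> :: 'a \<Rightarrow> ennreal)"
  have [measurable_cong, simp]: "sets L = sets borel" by (simp add: L_def)
  have LI: "(\<integral>\<^sup>+x\<in>\<Omega>. h x \<partial>lborel) = (\<integral>\<^sup>+x. h x \<partial>L)" if [measurable]: "h \<in> borel_measurable borel" for h :: "'a \<Rightarrow> ennreal"
    unfolding L_def by (subst nn_integral_density) (auto simp: mult.commute)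
  interpret L: finite_measure L
    by (rule finite_measureI) (use \<Omega>fin in \<open>simp add: L_def emeasure_density\<close>)
  have fm: "(\<lambda>x. f (v x)) \<in> borel_measurable borel" if "v \<in> borel_measurable borel" "\<And>x. 0 \<le> v x" for v :: "'a \<Rightarrow> real"
    by (rule borel_measurable_compose_nonneg[OF standing_f_continuous[OF f] that])
  have [measurable]: "(\<lambda>x. f (u x)) \<in> borel_measurable borel" "(\<lambda>x. f (w x)) \<in> borel_measurable borel"
    using u w by (auto intro!: fm)
  have [measurable]: "(\<lambda>x. f' (u x)) \<in> borel_measurable borel"
    by (rule borel_measurable_compose_nonneg) (use f u in \<open>auto simp: standing_f_def\<close>)
  have fpos: "0 \<le> f t" if "0 \<le> t" for t using f that by (simp add: standing_f_def)
  have Fen: "Fen f \<Omega> (density lborel (\<lambda>x. ennreal (v x))) = (\<integral>\<^sup>+x. ennreal (f (v x)) \<partial>L)"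
    if [measurable]: "v \<in> borel_measurable borel" and "\<And>x. 0 \<le> v x" for v :: "'a \<Rightarrow> real"
    using Fen_density[OF f \<Omega> that(1)] that fm[OF that] by (simp add: LI)
  have Wfin: "(\<integral>\<^sup>+x. ennreal (f (w x)) \<partial>L) < \<infinity>"
  proof -
    have "(\<integral>\<^sup>+x. ennreal (f (w x)) \<partial>L) \<le> (\<integral>\<^sup>+x. ennreal (f K) \<partial>L)"
      by (intro nn_integral_mono ennreal_leI standing_f_mono[OF f] w)
    also have "\<dots> < \<infinity>" by (simp add: less_top[symmetric] ennreal_mult_eq_top_iff)
    finally show ?thesis .
  qed
  have prob_on_e: "density lborel (\<lambda>x. ennreal ((1 - e) * u x + e * w x)) \<in> prob_on \<Omega>" (is "?\<mu>e \<in> _")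
    if e: "0 \<le> e" "e \<le> 1" for e
  proof -
    have em: "emeasure ?\<mu>e A = ennreal (1 - e) * emeasure \<mu> A + ennreal e * emeasure \<mu>' A" if "A \<in> sets borel" for A
      unfolding \<mu>_def \<mu>'_def by (rule emeasure_density_mixture) (use u w e that in auto)
    have m1: "emeasure \<mu> UNIV = 1" "emeasure \<mu> (UNIV - \<Omega>) = 0"
      using \<mu> prob_space.emeasure_space_1[of \<mu>] by (auto simp: prob_on_def \<mu>_def)
    have m2: "emeasure \<mu>' UNIV = 1"
      using prob_space.emeasure_space_1[OF \<mu>'] by (auto simp: \<mu>'_def)
    have m3: "emeasure \<mu>' (UNIV - \<Omega>) = 0"
      unfolding \<mu>'_def by (subst emeasure_density) (auto simp: w(3) nn_integral_0_iff_AE split: split_indicator)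
    show ?thesis
      unfolding prob_on_def
    proof (safe intro!: prob_spaceI)
      show "emeasure ?\<mu>e (space ?\<mu>e) = 1"
        using em[of UNIV] m1 m2 e by (simp flip: ennreal_plus)
      show "emeasure ?\<mu>e (UNIV - \<Omega>) = 0"
        using em[of "UNIV - \<Omega>"] m1 m3 by simp
    qed simp_all
  qed
  have Tp': "Tp p \<mu>' \<nu> \<le> ?C" unfolding Tp_def \<mu>'_def by (rule INF_lower[OF g'])
  \<comment> \<open>The competitor has bounded density and finite transport cost, so minimality
    forces both terms to be finite at \<open>\<mu>\<close>.\<close>
  have "Ffun p f \<Omega> \<nu> \<mu> \<le> Ffun p f \<Omega> \<nu> \<mu>'"
    using min prob_on_e[of 1] by (simp add: \<mu>'_def)
  also have "\<dots> < \<infinity>" unfolding Ffun_def using Fen[OF w_meas w(1)] Wfin Tp' Cfin by (auto simp: \<mu>'_def)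
  finally have "Ffun p f \<Omega> \<nu> \<mu> < \<infinity>" .
  then have Tfin: "Tp p \<mu> \<nu> < \<infinity>" and Ifin: "(\<integral>\<^sup>+x. ennreal (f (u x)) \<partial>L) < \<infinity>"
    unfolding Ffun_def using Fen[OF u_meas] u by (auto simp: \<mu>_def)
  define T where "T = enn2real (Tp p \<mu> \<nu>)"
  define C where "C = enn2real ?C"
  have T: "Tp p \<mu> \<nu> = ennreal T" "T \<ge> 0" using Tfin by (auto simp: T_def)
  have C: "?C = ennreal C" "C \<ge> 0" using Cfin by (auto simp: C_def)
  have iu: "integrable L (\<lambda>x. f (u x))" and iw: "integrable L (\<lambda>x. f (w x))"
    using Ifin Wfin fpos u w by (auto intro!: integrableI_nonneg)
  define I W where "I = (\<integral>x. f (u x) \<partial>L)" and "W = (\<integral>x. f (w x) \<partial>L)"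
  have I: "(\<integral>\<^sup>+x. ennreal (f (u x)) \<partial>L) = ennreal I" "0 \<le> I"
    unfolding I_def using iu fpos u by (auto intro!: nn_integral_eq_integral)
  have W: "(\<integral>\<^sup>+x. ennreal (f (w x)) \<partial>L) = ennreal W" "0 \<le> W"
    unfolding W_def using iw fpos w by (auto intro!: nn_integral_eq_integral)
  define ue where "ue n x = (1 - 1 / real (Suc n)) * u x + 1 / real (Suc n) * w x" for n x
  have ue0: "0 \<le> ue n x" for n x using u w by (simp add: ue_def)
  have [measurable]: "ue n \<in> borel_measurable borel" for n unfolding ue_def by measurable
  have [measurable]: "(\<lambda>x. f (ue n x)) \<in> borel_measurable borel" for n by (rule fm) (use ue0 in auto)
  have cvx: "f (ue n x) \<le> (1 - 1 / real (Suc n)) * f (u x) + 1 / real (Suc n) * f (w x)" for n x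
    unfolding ue_def by (rule standing_f_convex[OF f]) (use u w in auto)
  have ie: "integrable L (\<lambda>x. f (ue n x))" for n
  proof (rule Bochner_Integration.integrable_bound)
    show "integrable L (\<lambda>x. (1 - 1 / real (Suc n)) * f (u x) + 1 / real (Suc n) * f (w x))"
      using iu iw by (intro Bochner_Integration.integrable_add integrable_mult_right) auto
    show "AE x in L. norm (f (ue n x)) \<le> norm ((1 - 1 / real (Suc n)) * f (u x) + 1 / real (Suc n) * f (w x))"
      using cvx fpos[OF ue0] by (intro always_eventually allI) (smt (verit) real_norm_def)
  qed measurable
  \<comment> \<open>The increment of \<open>f\<close> from \<open>u\<close> to \<open>w\<close>
    minus the difference quotient in direction \<open>w - u\<close>. Convexity makes it nonnegative,
    as Fatou's lemma requires.\<close>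
  define h where "h n x = f (w x) - f (u x) - (f (ue n x) - f (u x)) * real (Suc n)" for n x
  have hpos: "0 \<le> h n x" for n x
  proof -
    have "real (Suc n) * f (ue n x) \<le> real (Suc n) * ((1 - 1 / real (Suc n)) * f (u x) + 1 / real (Suc n) * f (w x))"
      by (intro mult_left_mono cvx) auto
    also have "\<dots> = (real (Suc n) - 1) * f (u x) + f (w x)"
    proof -
      have "N * ((1 - 1 / N) * a + 1 / N * b) = (N - 1) * a + b" if "N \<noteq> 0" for N a b :: real
        using that by (simp add: field_simps)
      then show ?thesis by (metis of_nat_neq_0)
    qed
    finally show ?thesis by (simp add: h_def algebra_simps)
  qed
  have ih: "integrable L (h n)" for n
    unfolding h_def using iu iw ie by (intro Bochner_Integration.integrable_diff integrable_mult_left) auto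
  \<comment> \<open>Minimality tested on the mixture with weight \<open>1 / Suc n\<close>: transport
    is convex under mixing, and division by the weight leaves a bound on the energy
    quotient.\<close>
  have key: "T - C \<le> ((\<integral>x. f (ue n x) \<partial>L) - I) * real (Suc n)" for n
  proof -
    define e where "e = 1 / real (Suc n)"
    let ?\<mu>e = "density lborel (\<lambda>x. ennreal ((1 - e) * u x + e * w x))"
    have e: "0 \<le> e" "e \<le> 1" "e * real (Suc n) = 1" by (auto simp: e_def)
    have Ie: "(\<integral>\<^sup>+x. ennreal (f (ue n x)) \<partial>L) = ennreal (\<integral>x. f (ue n x) \<partial>L)" "0 \<le> (\<integral>x. f (ue n x) \<partial>L)"
      using ie fpos[OF ue0] by (auto intro!: nn_integral_eq_integral)
    have Te: "Tp p ?\<mu>e \<nu> \<le> ennreal (1 - e) * Tp p \<mu> \<nu> + ennreal e * ?C"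
    proof (rule Tp_mixture_le[OF g' e(1,2) _ _ Tfin])
      fix A :: "'a set" assume "A \<in> sets borel"
      then show "emeasure ?\<mu>e A = ennreal (1 - e) * emeasure \<mu> A + ennreal e * emeasure (density lborel (\<lambda>x. ennreal (w x))) A"
        unfolding \<mu>_def by (intro emeasure_density_mixture) (use u w e(1,2) in auto)
    qed simp
    have "ennreal (T + I) = Ffun p f \<Omega> \<nu> \<mu>"
      unfolding Ffun_def T \<mu>_def using Fen[OF u_meas] u I T \<mu>_def by simp
    also have "\<dots> \<le> Ffun p f \<Omega> \<nu> ?\<mu>e" using min prob_on_e[OF e(1,2)] by blast
    also have "\<dots> = Tp p ?\<mu>e \<nu> + ennreal (\<integral>x. f (ue n x) \<partial>L)"
      unfolding Ffun_def using Fen[of "ue n"] ue0 Ie by (simp add: ue_def e_def)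
    also have "\<dots> \<le> ennreal (1 - e) * Tp p \<mu> \<nu> + ennreal e * ?C + ennreal (\<integral>x. f (ue n x) \<partial>L)"
      by (rule add_right_mono[OF Te])
    also have "ennreal (1 - e) * Tp p \<mu> \<nu> + ennreal e * ?C = ennreal ((1 - e) * T + e * C)"
      unfolding T C using T(2) C(2) e(1,2) by (simp add: ennreal_mult)
    also have "ennreal ((1 - e) * T + e * C) + ennreal (\<integral>x. f (ue n x) \<partial>L) = ennreal ((1 - e) * T + e * C + (\<integral>x. f (ue n x) \<partial>L))"
      using T(2) C(2) e(1,2) Ie(2) by (intro ennreal_plus[symmetric]) auto
    finally have "T + I \<le> (1 - e) * T + e * C + (\<integral>x. f (ue n x) \<partial>L)"
      using T(2) C(2) e(1,2) Ie(2) by (subst (asm) ennreal_le_iff) auto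
    then have "e * (T - C) \<le> (\<integral>x. f (ue n x) \<partial>L) - I" by (simp add: algebra_simps)
    then have "(e * (T - C)) * real (Suc n) \<le> ((\<integral>x. f (ue n x) \<partial>L) - I) * real (Suc n)"
      by (intro mult_right_mono) auto
    moreover have "(e * (T - C)) * real (Suc n) = T - C"
      using e(3) by (metis mult.assoc mult.commute mult_1)
    ultimately show ?thesis by metis
  qed
  have hint: "(\<integral>x. h n x \<partial>L) \<le> W - I - (T - C)" for n
  proof -
    have "(\<integral>x. h n x \<partial>L) = W - I - ((\<integral>x. f (ue n x) \<partial>L) - I) * real (Suc n)"
      unfolding h_def W_def I_def using iu iw ie by simp
    then show ?thesis using key[of n] by linarith
  qed
  define B where "B = W - I - (T - C)"
  have "0 \<le> (\<integral>x. h 0 x \<partial>L)" by (rule Bochner_Integration.integral_nonneg) (rule hpos)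
  then have B0: "0 \<le> B" using hint[of 0] by (simp add: B_def)
  \<comment> \<open>The limit of \<open>h n\<close>, that is, the gap between \<open>f\<close> and
    its tangent at \<open>u x\<close>.\<close>
  define H where "H x = f (w x) - f (u x) - f' (u x) * (w x - u x)" for x
  have hlim: "(\<lambda>n. h n x) \<longlonglongrightarrow> H x" for x
    unfolding h_def H_def ue_def
    by (intro tendsto_intros standing_f_quotient_tendsto[OF f]) (use u w in auto)
  have "(\<integral>\<^sup>+x. ennreal (H x) \<partial>L) = (\<integral>\<^sup>+x. liminf (\<lambda>n. ennreal (h n x)) \<partial>L)"
    by (intro nn_integral_cong lim_imp_Liminf[symmetric] tendsto_ennrealI hlim) auto
  also have "\<dots> \<le> liminf (\<lambda>n. \<integral>\<^sup>+x. ennreal (h n x) \<partial>L)"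
    by (rule nn_integral_liminf) (unfold h_def, measurable)
  also have "\<dots> \<le> liminf (\<lambda>n. ennreal B)"
  proof (intro Liminf_mono always_eventually allI)
    fix n
    have "(\<integral>\<^sup>+x. ennreal (h n x) \<partial>L) = ennreal (\<integral>x. h n x \<partial>L)"
      using ih hpos by (intro nn_integral_eq_integral) auto
    then show "(\<integral>\<^sup>+x. ennreal (h n x) \<partial>L) \<le> ennreal B"
      using hint[of n] by (simp add: B_def ennreal_leI)
  qed
  also have "\<dots> = ennreal B" by (simp add: Liminf_const)
  finally have HB: "(\<integral>\<^sup>+x. ennreal (H x) \<partial>L) \<le> ennreal B" .
  have H0: "0 \<le> H x" for x
    using standing_f_tangent[OF f, of "u x" "w x"] u w by (simp add: H_def)
  have [measurable]: "H \<in> borel_measurable borel" unfolding H_def by measurable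
  have fp: "0 \<le> f' (u x)" for x using standing_f_deriv_nonneg[OF f] u by blast
  let ?A = "\<integral>\<^sup>+x. ennreal (f' (u x) * u x) \<partial>L" and ?B = "\<integral>\<^sup>+x. ennreal (f' (u x) * w x) \<partial>L"
  \<comment> \<open>The rearrangement is done with nonnegative terms only, since \<open>?A\<close>
    and \<open>?B\<close> may be infinite and cannot be subtracted. Only the finite \<open>W\<close>
    is cancelled at the end.\<close>
  have "?A + ennreal W = (\<integral>\<^sup>+x. ennreal (f' (u x) * u x) + ennreal (f (w x)) \<partial>L)"
    unfolding W(1)[symmetric] by (rule nn_integral_add[symmetric]) auto
  also have "\<dots> = (\<integral>\<^sup>+x. (ennreal (H x) + ennreal (f (u x))) + ennreal (f' (u x) * w x) \<partial>L)"
  proof (rule nn_integral_cong)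
    fix x
    have "f' (u x) * u x + f (w x) = H x + f (u x) + f' (u x) * w x" by (simp add: H_def algebra_simps)
    then show "ennreal (f' (u x) * u x) + ennreal (f (w x)) = (ennreal (H x) + ennreal (f (u x))) + ennreal (f' (u x) * w x)"
      using u w fp H0 fpos by (simp flip: ennreal_plus)
  qed
  also have "\<dots> = (\<integral>\<^sup>+x. ennreal (H x) \<partial>L) + ennreal I + ?B"
    unfolding I(1)[symmetric] by (subst nn_integral_add, simp, simp, subst nn_integral_add) auto
  also have "\<dots> \<le> ennreal B + ennreal I + ?B" by (intro add_right_mono HB)
  finally have "?A + ennreal W + ennreal T \<le> ennreal B + ennreal I + ?B + ennreal T" by (rule add_right_mono)
  also have "\<dots> = ennreal (B + I + T) + ?B"
    using B0 I(2) T(2) by (simp add: add_ac)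
  also have "ennreal (B + I + T) = ennreal W + ennreal C"
    using W(2) C(2) by (simp add: B_def)
  finally have "ennreal W + (?A + ennreal T) \<le> ennreal W + (?B + ennreal C)" by (simp add: add_ac)
  then have "?A + ennreal T \<le> ?B + ennreal C" by (simp add: ennreal_add_left_cancel_le)
  then show ?thesis unfolding T(1) C(1) by (subst (1 2) LI) auto
qed

lemma open_imp_emeasure_lborel_pos:
  fixes V :: "'a::euclidean_space set"
  assumes "open V" "V \<noteq> {}"
  shows "emeasure lborel V \<noteq> 0"
proof -
  obtain x r where r: "r > 0" "ball x r \<subseteq> V" using assms open_contains_ball by blast
  have "0 < emeasure lborel (ball x r)"
    using r by (simp add: emeasure_ball)
  also have "\<dots> \<le> emeasure lborel V" using assms r by (intro emeasure_mono) auto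
  finally show ?thesis by simp
qed

section \<open>Construction of near-optimal competitors\<close>

context power_cost
begin

lemma \<Omega>_borel[measurable]: "\<Omega> \<in> sets borel"
  using compact_\<Omega> by (simp add: borel_compact)

lemma emeasure_\<Omega>_finite: "emeasure lborel \<Omega> < \<infinity>"
  using emeasure_compact_finite[OF compact_\<Omega>] by simp

lemma borel_measurable_indicator_continuous:
  fixes h :: "'a \<Rightarrow> real"
  assumes "continuous_on \<Omega> h"
  shows "(\<lambda>x. indicator \<Omega> x * h x) \<in> borel_measurable borel"
  using borel_measurable_continuous_on_indicator[OF \<Omega>_borel assms] by simp

section \<open>Dual optimality of a minimiser\<close>

text \<open>Each \<open>y\<close> is coupled to almost minimisers of \<open>c x y + a x\<close>,
  smeared over sets of positive measure so that the first marginal has a bounded density. Finitely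
  many small balls cover \<open>\<Omega>\<close>, and all \<open>y\<close> near a centre share its
  almost minimisers. The infimum over \<open>E\<close> acts as an essential infimum, by
  \<open>supp\<close>.\<close>

lemma ex_near_optimal_plan:
  fixes a :: "'a \<Rightarrow> real"
  assumes a_meas[measurable]: "a \<in> borel_measurable borel" and a: "\<And>x. 0 \<le> a x"
    and nu: "\<nu> \<in> prob_on \<Omega>"
    and E: "E \<subseteq> \<Omega>" "E \<noteq> {}"
    and supp: "\<And>x V. x \<in> E \<Longrightarrow> open V \<Longrightarrow> (x, a x) \<in> V \<Longrightarrow> emeasure lborel {x'\<in>\<Omega>. (x', a x') \<in> V} \<noteq> 0"
    and \<delta>: "\<delta> > 0"
  defines "g \<equiv> \<lambda>y. INF x\<in>E. c x y - (- a x)"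
  shows "\<exists>w K \<gamma>. w \<in> borel_measurable borel \<and> (\<forall>x. 0 \<le> w x) \<and> (\<forall>x. w x \<le> K) \<and> (\<forall>x. x \<notin> \<Omega> \<longrightarrow> w x = 0) \<and>
     \<gamma> \<in> transport_plans (density lborel (\<lambda>x. ennreal (w x))) \<nu> \<and>
     (\<integral>\<^sup>+x\<in>\<Omega>. ennreal (a x * w x) \<partial>lborel) + (\<integral>\<^sup>+z. ennreal (c (fst z) (snd z)) \<partial>\<gamma>) \<le> (\<integral>\<^sup>+y\<in>\<Omega>. ennreal (g y + \<delta>) \<partial>\<nu>)"
proof -
  have nuS[measurable_cong, simp]: "sets \<nu> = sets borel" and nuP: "prob_space \<nu>" and nu0: "emeasure \<nu> (UNIV - \<Omega>) = 0"
    using nu by (auto simp: prob_on_def)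
  interpret nu: prob_space \<nu> by (rule nuP)
  interpret P: pair_sigma_finite lborel \<nu>
    by (intro pair_sigma_finite.intro sigma_finite_lborel nu.sigma_finite_measure)
  have bd: "bdd_above ((\<lambda>x. - a x) ` E)" using a by (intro bdd_aboveI2[where M=0]) auto
  have gcont: "continuous_on \<Omega> g" unfolding g_def by (rule continuous_on_inf_cost[OF E bd])
  have [measurable]: "(\<lambda>y. indicator \<Omega> y * g y) \<in> borel_measurable borel"
    by (rule borel_measurable_indicator_continuous[OF gcont])
  have gpos: "0 \<le> g y" for y unfolding g_def using a E by (intro cINF_greatest) auto
  obtain d1 where d1: "d1 > 0" "\<And>x y y'. x \<in> \<Omega> \<Longrightarrow> y \<in> \<Omega> \<Longrightarrow> y' \<in> \<Omega> \<Longrightarrow> dist y y' < d1 \<Longrightarrow> \<bar>c x y - c x y'\<bar> < \<delta>/4"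
    using cost_uniform[of "\<delta>/4"] \<delta> by auto
  obtain d2 where d2: "d2 > 0" "\<And>y y'. y \<in> \<Omega> \<Longrightarrow> y' \<in> \<Omega> \<Longrightarrow> dist y' y < d2 \<Longrightarrow> dist (g y') (g y) < \<delta>/4"
    using compact_uniformly_continuous[OF gcont compact_\<Omega>] \<delta> unfolding uniformly_continuous_on_def
    by (metis zero_less_divide_iff zero_less_numeral)
  \<comment> \<open>Within distance \<open>d\<close> both the cost and \<open>g\<close> move by less
    than \<open>\<delta>/4\<close>; with the slack \<open>\<delta>/2\<close> in \<open>S j\<close>
    this totals \<open>\<delta>\<close>.\<close>
  define d where "d = min d1 d2"
  have d: "d > 0" "d \<le> d1" "d \<le> d2" using d1 d2 by (auto simp: d_def)
  obtain J where J: "J \<subseteq> \<Omega>" "finite J" "\<Omega> \<subseteq> (\<Union>j\<in>J. ball j d)"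
    using compactE_image[OF compact_\<Omega>, of \<Omega> "\<lambda>j. ball j d"] d(1) by (metis UN_I centre_in_ball open_ball subsetI)
  define S where "S j = {x\<in>\<Omega>. c x j + a x < g j + \<delta>/2}" for j
  have cm[measurable]: "(\<lambda>x. c x j) \<in> borel_measurable borel" for j :: 'a
    using measurable_compose[OF measurable_Pair[OF measurable_ident_sets[OF refl] measurable_const[of j]] cost_measurable] by simp
  have S_meas[measurable]: "S j \<in> sets borel" for j unfolding S_def by measurable
  have S\<Omega>: "S j \<subseteq> \<Omega>" for j by (auto simp: S_def)
  have S_fin: "emeasure lborel (S j) < \<infinity>" for j
    using emeasure_mono[OF S\<Omega>, of lborel] emeasure_\<Omega>_finite by (auto intro: le_less_trans)
  \<comment> \<open>Some \<open>x\<close> in \<open>E\<close> satisfies the strict inequality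
    defining \<open>S j\<close>. That condition is open in the pair \<open>(x, a x)\<close>, so
    \<open>supp\<close> gives it positive measure.\<close>
  have S_pos: "emeasure lborel (S j) \<noteq> 0" if "j \<in> J" for j
  proof -
    have "g j < g j + \<delta>/2" using \<delta> by simp
    then obtain x where x: "x \<in> E" "c x j - (- a x) < g j + \<delta>/2"
      unfolding g_def using cINF_less_iff[OF E(2) bdd_below_cost[OF bd]] by blast
    let ?V = "{z::'a\<times>real. c (fst z) j + snd z < g j + \<delta>/2}"
    have "open ?V"
      using p_gt_1 by (intro open_Collect_less continuous_intros continuous_on_powr') auto
    moreover have "(x, a x) \<in> ?V" using x by simp
    ultimately have "emeasure lborel {x'\<in>\<Omega>. (x', a x') \<in> ?V} \<noteq> 0" by (rule supp[OF x(1)])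
    then show ?thesis by (simp add: S_def)
  qed
  define m where "m j = measure lborel (S j)" for j
  have m: "emeasure lborel (S j) = ennreal (m j)" for j
    unfolding m_def using S_fin[of j] by (intro emeasure_eq_ennreal_measure) auto
  have m0: "m j > 0" if "j \<in> J" for j
    using S_pos[OF that] m[of j] by (metis ennreal_0 less_eq_real_def m_def measure_nonneg)
  \<comment> \<open>\<open>wj j\<close> is the uniform density on \<open>S j\<close>; normalising
    the indicators of the balls makes \<open>\<theta>\<close> a Borel partition of unity on
    \<open>\<Omega>\<close>.\<close>
  define wj where "wj j x = indicator (S j) x / m j" for j x
  define N where "N y = (\<Sum>j\<in>J. indicator (ball j d) y :: real)" for y
  define \<theta> where "\<theta> j y = indicator (ball j d \<inter> \<Omega>) y / N y" for j y
  have [measurable]: "wj j \<in> borel_measurable borel" for j unfolding wj_def by measurable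
  have [measurable]: "ball j d \<in> sets borel" for j :: 'a by simp
  have [measurable]: "N \<in> borel_measurable borel" unfolding N_def by measurable
  have [measurable]: "\<theta> j \<in> borel_measurable borel" for j unfolding \<theta>_def by measurable
  have wj0: "0 \<le> wj j x" for j x by (simp add: wj_def m_def)
  have N0: "0 \<le> N y" for y unfolding N_def by (intro sum_nonneg) auto
  have N1: "N y \<ge> 1" if y: "y \<in> \<Omega>" for y
  proof -
    obtain j where "j \<in> J" "y \<in> ball j d" using J y by auto
    then have "1 = indicator (ball j d) y" by simp
    also have "\<dots> \<le> N y" unfolding N_def by (rule member_le_sum) (use J \<open>j \<in> J\<close> in auto)
    finally show ?thesis .
  qed
  have \<theta>0: "0 \<le> \<theta> j y" for j y using N0 by (simp add: \<theta>_def)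
  have \<theta>sum: "(\<Sum>j\<in>J. \<theta> j y) = 1" if "y \<in> \<Omega>" for y
  proof -
    have "(\<Sum>j\<in>J. \<theta> j y) = (\<Sum>j\<in>J. indicator (ball j d) y) / N y"
      using that by (simp add: \<theta>_def sum_divide_distrib indicator_inter_arith)
    also have "\<dots> = 1" using N1[OF that] by (simp add: N_def)
    finally show ?thesis .
  qed
  have \<theta>1: "\<theta> j y \<le> 1" if "j \<in> J" for j y
  proof (cases "y \<in> \<Omega>")
    case True
    have "\<theta> j y \<le> (\<Sum>j\<in>J. \<theta> j y)" by (rule member_le_sum) (use J that \<theta>0 in auto)
    then show ?thesis using \<theta>sum[OF True] by simp
  next
    case False then show ?thesis by (simp add: \<theta>_def)
  qed
  \<comment> \<open>For fixed \<open>y\<close> in \<open>\<Omega>\<close>, the probability density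
    of the point coupled to \<open>y\<close>; integrating out \<open>y\<close> gives the first
    marginal density \<open>w\<close>.\<close>
  define q where "q x y = (\<Sum>j\<in>J. \<theta> j y * wj j x)" for x y
  have q_meas[measurable]: "(\<lambda>z. q (fst z) (snd z)) \<in> borel_measurable (borel \<Otimes>\<^sub>M borel)" unfolding q_def by measurable
  have [measurable]: "(\<lambda>x. q x y) \<in> borel_measurable borel" "(\<lambda>y. q x y) \<in> borel_measurable borel" for x y
    unfolding q_def by measurable
  have q0: "0 \<le> q x y" for x y unfolding q_def using \<theta>0 wj0 by (intro sum_nonneg) auto
  define A where "A j = (\<integral>y. \<theta> j y \<partial>\<nu>)" for j
  define w where "w x = (\<Sum>j\<in>J. A j * wj j x)" for x
  have [measurable]: "w \<in> borel_measurable borel" unfolding w_def by measurable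
  have A0: "0 \<le> A j" for j unfolding A_def using \<theta>0 by (intro Bochner_Integration.integral_nonneg) auto
  have i\<theta>: "integrable \<nu> (\<theta> j)" if "j \<in> J" for j
    using \<theta>0 \<theta>1[OF that] by (intro nu.integrable_const_bound[where B=1]) auto
  have w0: "0 \<le> w x" for x unfolding w_def using A0 wj0 by (intro sum_nonneg) auto
  have wK: "w x \<le> (\<Sum>j\<in>J. A j * (1 / m j))" for x
    unfolding w_def wj_def using A0 m0
    by (intro sum_mono mult_left_mono divide_right_mono) (auto simp: indicator_le_1 less_imp_le)
  have woff: "w x = 0" if "x \<notin> \<Omega>" for x
    unfolding w_def wj_def using that S\<Omega> by (intro sum.neutral) (auto simp: indicator_def)
  have qy: "(\<integral>\<^sup>+y. ennreal (q x y) \<partial>\<nu>) = ennreal (w x)" for x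
  proof -
    have "(\<integral>\<^sup>+y. ennreal (q x y) \<partial>\<nu>) = ennreal (\<integral>y. q x y \<partial>\<nu>)"
      using q0 i\<theta> by (intro nn_integral_eq_integral) (auto simp: q_def)
    also have "(\<integral>y. q x y \<partial>\<nu>) = w x"
      unfolding q_def w_def A_def using i\<theta> by (subst Bochner_Integration.integral_sum) auto
    finally show ?thesis .
  qed
  have wj1: "(\<integral>\<^sup>+x. ennreal (wj j x) \<partial>lborel) = 1" if "j \<in> J" for j
  proof -
    have "(\<integral>\<^sup>+x. ennreal (wj j x) \<partial>lborel) = (\<integral>\<^sup>+x. ennreal (1 / m j) * indicator (S j) x \<partial>lborel)"
      by (intro nn_integral_cong) (auto simp: wj_def indicator_def)
    also have "\<dots> = ennreal (1 / m j) * ennreal (m j)" by (simp add: nn_integral_cmult_indicator m)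
    also have "\<dots> = 1" using m0[OF that] by (simp flip: ennreal_mult)
    finally show ?thesis .
  qed
  have qx: "(\<integral>\<^sup>+x. ennreal (q x y) \<partial>lborel) = 1" if "y \<in> \<Omega>" for y
  proof -
    have "(\<integral>\<^sup>+x. ennreal (q x y) \<partial>lborel) = (\<integral>\<^sup>+x. (\<Sum>j\<in>J. ennreal (\<theta> j y) * ennreal (wj j x)) \<partial>lborel)"
      unfolding q_def using \<theta>0 wj0 by (intro nn_integral_cong) (simp flip: ennreal_mult sum_ennreal)
    also have "\<dots> = (\<Sum>j\<in>J. ennreal (\<theta> j y) * (\<integral>\<^sup>+x. ennreal (wj j x) \<partial>lborel))"
      by (subst nn_integral_sum) (auto simp: nn_integral_cmult)
    also have "\<dots> = (\<Sum>j\<in>J. ennreal (\<theta> j y))" by (intro sum.cong) (auto simp: wj1)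
    also have "\<dots> = ennreal (\<Sum>j\<in>J. \<theta> j y)" by (rule sum_ennreal) (rule \<theta>0)
    finally show ?thesis using \<theta>sum[OF that] by simp
  qed
  define \<gamma> where "\<gamma> = density (lborel \<Otimes>\<^sub>M \<nu>) (\<lambda>z. ennreal (q (fst z) (snd z)))"
  have sg[measurable_cong]: "sets \<gamma> = sets (borel \<Otimes>\<^sub>M borel)"
    unfolding \<gamma>_def sets_density by (rule sets_pair_measure_cong) auto
  have ig: "(\<integral>\<^sup>+z. h z \<partial>\<gamma>) = (\<integral>\<^sup>+z. ennreal (q (fst z) (snd z)) * h z \<partial>(lborel \<Otimes>\<^sub>M \<nu>))"
    if [measurable]: "h \<in> borel_measurable (borel \<Otimes>\<^sub>M borel)" for h
    unfolding \<gamma>_def by (rule nn_integral_density) measurable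
  have ifst: "(\<integral>\<^sup>+z. h (fst z) \<partial>\<gamma>) = (\<integral>\<^sup>+x. ennreal (w x) * h x \<partial>lborel)"
    if [measurable]: "h \<in> borel_measurable borel" for h
  proof -
    have "(\<integral>\<^sup>+z. h (fst z) \<partial>\<gamma>) = (\<integral>\<^sup>+z. ennreal (q (fst z) (snd z)) * h (fst z) \<partial>(lborel \<Otimes>\<^sub>M \<nu>))"
      by (rule ig) measurable
    also have "\<dots> = (\<integral>\<^sup>+x. \<integral>\<^sup>+y. ennreal (q x y) * h x \<partial>\<nu> \<partial>lborel)"
      by (subst nu.nn_integral_fst[symmetric]) (simp_all, measurable)
    also have "\<dots> = (\<integral>\<^sup>+x. ennreal (w x) * h x \<partial>lborel)"
      by (intro nn_integral_cong) (simp add: nn_integral_multc qy)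
    finally show ?thesis .
  qed
  \<comment> \<open>Outside \<open>\<Omega>\<close> the kernel \<open>q\<close> vanishes, so the
    second marginal equals \<open>\<nu>\<close> because \<open>\<nu>\<close> is carried by
    \<open>\<Omega>\<close>.\<close>
  have AEnu: "AE y in \<nu>. y \<in> \<Omega>"
    by (rule AE_I[of _ _ "UNIV - \<Omega>"]) (auto simp: nu0)
  have isnd: "(\<integral>\<^sup>+z. h (snd z) \<partial>\<gamma>) = (\<integral>\<^sup>+y. h y \<partial>\<nu>)"
    if [measurable]: "h \<in> borel_measurable borel" for h
  proof -
    have "(\<integral>\<^sup>+z. h (snd z) \<partial>\<gamma>) = (\<integral>\<^sup>+z. ennreal (q (fst z) (snd z)) * h (snd z) \<partial>(lborel \<Otimes>\<^sub>M \<nu>))"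
      by (rule ig) measurable
    also have "\<dots> = (\<integral>\<^sup>+y. \<integral>\<^sup>+x. ennreal (q x y) * h y \<partial>lborel \<partial>\<nu>)"
      by (subst P.nn_integral_snd[symmetric]) (simp_all, measurable)
    also have "\<dots> = (\<integral>\<^sup>+y. h y \<partial>\<nu>)"
      by (rule nn_integral_cong_AE, rule AE_mp[OF AEnu]) (simp add: nn_integral_multc qx)
    finally show ?thesis .
  qed
  have plan: "\<gamma> \<in> transport_plans (density lborel (\<lambda>x. ennreal (w x))) \<nu>"
    unfolding transport_plans_def mem_Collect_eq
  proof (intro conjI sg)
    have em: "emeasure (distr \<gamma> borel t) B = (\<integral>\<^sup>+z. indicator B (t z) \<partial>\<gamma>)"
      if [measurable]: "B \<in> sets borel" "t \<in> measurable (borel \<Otimes>\<^sub>M borel) borel" for B and t :: "'a\<times>'a \<Rightarrow> 'a"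
    proof -
      have "emeasure (distr \<gamma> borel t) B = (\<integral>\<^sup>+x. indicator B x \<partial>(distr \<gamma> borel t))" by simp
      also have "\<dots> = (\<integral>\<^sup>+z. indicator B (t z) \<partial>\<gamma>)" by (rule nn_integral_distr) measurable
      finally show ?thesis .
    qed
    show "distr \<gamma> borel fst = density lborel (\<lambda>x. ennreal (w x))"
      by (rule measure_eqI) (auto simp: em ifst emeasure_density)
    show "distr \<gamma> borel snd = \<nu>"
      by (rule measure_eqI) (auto simp: em isnd)
    show "prob_space \<gamma>"
    proof
      have "emeasure \<gamma> (space \<gamma>) = (\<integral>\<^sup>+z. 1 \<partial>\<gamma>)" by simp
      also have "\<dots> = 1" using isnd[of "\<lambda>_. 1"] nu.emeasure_space_1 by simp
      finally show "emeasure \<gamma> (space \<gamma>) = 1" .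
    qed
  qed
  have near: "a x + c x y \<le> g y + \<delta> \<and> y \<in> \<Omega>" if "q x y \<noteq> 0" for x y
  proof -
    obtain j where j: "j \<in> J" "\<theta> j y * wj j x \<noteq> 0" using \<open>q x y \<noteq> 0\<close> unfolding q_def by (meson sum.not_neutral_contains_not_neutral)
    then have y: "y \<in> \<Omega>" "dist j y < d" and x: "x \<in> S j"
      by (auto simp: \<theta>_def wj_def indicator_def split: if_splits)
    have x': "x \<in> \<Omega>" "c x j + a x < g j + \<delta>/2" using x by (auto simp: S_def)
    have "j \<in> \<Omega>" using j J by auto
    then have "\<bar>c x j - c x y\<bar> < \<delta>/4" "\<bar>g j - g y\<bar> < \<delta>/4"
      using d1(2)[of x j y] d2(2)[of y j] x' y d by (auto simp: dist_real_def)
    then show ?thesis using x' y(1) by linarith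
  qed
  have "(\<integral>\<^sup>+x\<in>\<Omega>. ennreal (a x * w x) \<partial>lborel) = (\<integral>\<^sup>+x. ennreal (w x) * ennreal (a x) \<partial>lborel)"
    using woff a w0 by (intro nn_integral_cong) (auto simp: ennreal_mult mult.commute indicator_def)
  also have "\<dots> = (\<integral>\<^sup>+z. ennreal (a (fst z)) \<partial>\<gamma>)" by (rule ifst[symmetric]) measurable
  finally have "(\<integral>\<^sup>+x\<in>\<Omega>. ennreal (a x * w x) \<partial>lborel) + (\<integral>\<^sup>+z. ennreal (c (fst z) (snd z)) \<partial>\<gamma>)
     = (\<integral>\<^sup>+z. ennreal (a (fst z)) \<partial>\<gamma>) + (\<integral>\<^sup>+z. ennreal (c (fst z) (snd z)) \<partial>\<gamma>)" by simp
  also have "\<dots> = (\<integral>\<^sup>+z. ennreal (a (fst z)) + ennreal (c (fst z) (snd z)) \<partial>\<gamma>)"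
    by (rule nn_integral_add[symmetric]) measurable
  also have "\<dots> = (\<integral>\<^sup>+z. ennreal (q (fst z) (snd z)) * (ennreal (a (fst z)) + ennreal (c (fst z) (snd z))) \<partial>(lborel \<Otimes>\<^sub>M \<nu>))"
    by (rule ig) measurable
  also have "\<dots> \<le> (\<integral>\<^sup>+z. ennreal (q (fst z) (snd z)) * (ennreal (indicator \<Omega> (snd z) * g (snd z) + \<delta>) * indicator \<Omega> (snd z)) \<partial>(lborel \<Otimes>\<^sub>M \<nu>))"
  proof (rule nn_integral_mono)
    fix z :: "'a \<times> 'a"
    show "ennreal (q (fst z) (snd z)) * (ennreal (a (fst z)) + ennreal (c (fst z) (snd z)))
      \<le> ennreal (q (fst z) (snd z)) * (ennreal (indicator \<Omega> (snd z) * g (snd z) + \<delta>) * indicator \<Omega> (snd z))"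
    proof (cases "q (fst z) (snd z) = 0")
      case False
      from near[OF this] have "ennreal (a (fst z)) + ennreal (c (fst z) (snd z)) \<le> ennreal (g (snd z) + \<delta>)" "snd z \<in> \<Omega>"
        using a by (auto simp: ennreal_leI simp flip: ennreal_plus)
      then show ?thesis by (intro mult_left_mono) auto
    qed simp
  qed
  also have "\<dots> = (\<integral>\<^sup>+z. ennreal (indicator \<Omega> (snd z) * g (snd z) + \<delta>) * indicator \<Omega> (snd z) \<partial>\<gamma>)"
    by (rule ig[symmetric]) measurable
  also have "\<dots> = (\<integral>\<^sup>+y. ennreal (indicator \<Omega> y * g y + \<delta>) * indicator \<Omega> y \<partial>\<nu>)"
    by (rule isnd) measurable
  also have "\<dots> = (\<integral>\<^sup>+y\<in>\<Omega>. ennreal (g y + \<delta>) \<partial>\<nu>)"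
    by (intro nn_integral_cong) (auto simp: indicator_def)
  finally show ?thesis using plan w0 wK woff \<open>w \<in> borel_measurable borel\<close> by blast
qed


lemma set_integrable_continuous:
  fixes h :: "'a \<Rightarrow> real"
  assumes "continuous_on \<Omega> h" "M \<in> prob_on \<Omega>"
  shows "set_integrable M \<Omega> h"
proof -
  have M: "sets M = sets borel" "prob_space M" using assms(2) by (auto simp: prob_on_def)
  interpret prob_space M by (rule M)
  obtain B where B: "\<And>x. x \<in> \<Omega> \<Longrightarrow> \<bar>h x\<bar> \<le> B"
    using compact_imp_bounded[OF compact_continuous_image[OF assms(1) compact_\<Omega>]]
    by (auto simp: bounded_iff)
  have "(\<lambda>x. indicator \<Omega> x * h x) \<in> borel_measurable M"
    using borel_measurable_indicator_continuous[OF assms(1)] measurable_cong_sets[OF M(1) refl] by blast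
  moreover have "norm (indicator \<Omega> x * h x) \<le> max 0 B" for x
    using B[of x] by (auto simp: indicator_def)
  ultimately show ?thesis
    unfolding set_integrable_def by (intro integrable_const_bound[where B="max 0 B"]) auto
qed

lemma continuous_on_ctrans_continuous: "continuous_on \<Omega> h \<Longrightarrow> continuous_on \<Omega> (ct h)"
  by (intro continuous_on_ctrans bdd_above_continuous)

section \<open>Kantorovich potentials\<close>

text \<open>Potentials compete among c-concave functions only. Replacing a continuous
  \<open>\<xi>\<close> by its double transform makes it c-concave and decreases neither of the two
  integrals.\<close>

lemma kant_dual_le_potential:
  assumes pot: "kantorovich_potential \<Omega> p \<mu> \<nu> \<psi>" and \<xi>: "continuous_on \<Omega> \<xi>"
    and mu: "\<mu> \<in> prob_on \<Omega>" and nu: "\<nu> \<in> prob_on \<Omega>"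
  shows "kant_dual \<Omega> p \<mu> \<nu> \<xi> \<le> kant_dual \<Omega> p \<mu> \<nu> \<psi>"
proof -
  note 1 = continuous_on_ctrans_continuous[OF \<xi>]
  note 2 = continuous_on_ctrans_continuous[OF 1]
  note 3 = continuous_on_ctrans_continuous[OF 2]
  have "kant_dual \<Omega> p \<mu> \<nu> \<xi> \<le> kant_dual \<Omega> p \<mu> \<nu> (ct (ct \<xi>))"
    unfolding kant_dual_def
    by (intro add_mono set_integral_mono set_integrable_continuous mu nu \<xi> 1 2 3 le_ctrans_ctrans bdd_above_continuous)
  also have "\<dots> \<le> kant_dual \<Omega> p \<mu> \<nu> \<psi>"
    using pot c_concave_ctrans[OF bdd_above_continuous[OF 1]] by (simp add: kantorovich_potential_def)
  finally show ?thesis .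
qed

text \<open>Weak duality: the pointwise bound of \<open>\<xi> x + ct \<xi> y\<close> by the cost is
  integrated against an arbitrary plan.\<close>

lemma kant_dual_le_Tp:
  assumes \<xi>: "continuous_on \<Omega> \<xi>" and mu: "\<mu> \<in> prob_on \<Omega>" and nu: "\<nu> \<in> prob_on \<Omega>"
  shows "ennreal (kant_dual \<Omega> p \<mu> \<nu> \<xi>) \<le> Tp p \<mu> \<nu>"
  unfolding Tp_def
proof (rule INF_greatest)
  fix \<gamma> assume "\<gamma> \<in> transport_plans \<mu> \<nu>"
  then have G[measurable_cong]: "sets \<gamma> = sets (borel \<Otimes>\<^sub>M borel)" and "prob_space \<gamma>"
    and D: "distr \<gamma> borel fst = \<mu>" "distr \<gamma> borel snd = \<nu>"
    by (auto simp: transport_plans_def)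
  interpret prob_space \<gamma> by fact
  note \<xi>c = continuous_on_ctrans_continuous[OF \<xi>]
  define A B where "A x = indicator \<Omega> x * \<xi> x" and "B y = indicator \<Omega> y * ct \<xi> y" for x y
  have [measurable]: "A \<in> borel_measurable borel" "B \<in> borel_measurable borel"
    unfolding A_def B_def by (intro borel_measurable_indicator_continuous \<xi> \<xi>c)+
  have A: "(LINT x:\<Omega>|\<mu>. \<xi> x) = (\<integral>z. A (fst z) \<partial>\<gamma>) \<and> integrable \<gamma> (\<lambda>z. A (fst z))"
  proof -
    have "integrable (distr \<gamma> borel fst) A"
      using set_integrable_continuous[OF \<xi> mu] by (simp add: D set_integrable_def A_def[abs_def])
    then have "integrable \<gamma> (\<lambda>z. A (fst z))" by (rule integrable_distr[rotated]) measurable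
    moreover have "(LINT x:\<Omega>|\<mu>. \<xi> x) = (\<integral>x. A x \<partial>distr \<gamma> borel fst)"
      by (simp add: D set_lebesgue_integral_def A_def)
    moreover have "(\<integral>x. A x \<partial>distr \<gamma> borel fst) = (\<integral>z. A (fst z) \<partial>\<gamma>)"
      by (rule integral_distr) measurable
    ultimately show ?thesis by simp
  qed
  have B: "(LINT x:\<Omega>|\<nu>. ct \<xi> x) = (\<integral>z. B (snd z) \<partial>\<gamma>) \<and> integrable \<gamma> (\<lambda>z. B (snd z))"
  proof -
    have "integrable (distr \<gamma> borel snd) B"
      using set_integrable_continuous[OF \<xi>c nu] by (simp add: D set_integrable_def B_def[abs_def])
    then have "integrable \<gamma> (\<lambda>z. B (snd z))" by (rule integrable_distr[rotated]) measurable
    moreover have "(LINT x:\<Omega>|\<nu>. ct \<xi> x) = (\<integral>x. B x \<partial>distr \<gamma> borel snd)"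
      by (simp add: D set_lebesgue_integral_def B_def)
    moreover have "(\<integral>x. B x \<partial>distr \<gamma> borel snd) = (\<integral>z. B (snd z) \<partial>\<gamma>)"
      by (rule integral_distr) measurable
    ultimately show ?thesis by simp
  qed
  have dAE: "AE z in \<gamma>. t z \<in> \<Omega>" if "distr \<gamma> borel t \<in> prob_on \<Omega>" "t \<in> measurable (borel \<Otimes>\<^sub>M borel) borel" for t
  proof -
    have [measurable]: "t \<in> measurable \<gamma> borel" using that(2) by measurable
    have "AE x in distr \<gamma> borel t. x \<in> \<Omega>"
      using that(1) by (intro AE_I[of _ _ "UNIV - \<Omega>"]) (auto simp: prob_on_def)
    then show ?thesis by (subst (asm) AE_distr_iff) auto
  qed
  have AE: "AE z in \<gamma>. fst z \<in> \<Omega> \<and> snd z \<in> \<Omega>"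
    using dAE[of fst] dAE[of snd] mu nu D by auto
  \<comment> \<open>The positive part passes to the nonnegative integral; it is still below the
    cost, which is nonnegative.\<close>
  have le: "AE z in \<gamma>. max 0 (A (fst z) + B (snd z)) \<le> c (fst z) (snd z)"
    using AE
  proof eventually_elim
    case (elim z)
    then show ?case using ctrans_le[OF bdd_above_continuous[OF \<xi>], of "fst z" "snd z"]
      by (simp add: A_def B_def)
  qed
  have i: "integrable \<gamma> (\<lambda>z. max 0 (A (fst z) + B (snd z)))" using A B by auto
  have "kant_dual \<Omega> p \<mu> \<nu> \<xi> = (\<integral>z. A (fst z) + B (snd z) \<partial>\<gamma>)"
    unfolding kant_dual_def using A B by simp
  also have "\<dots> \<le> (\<integral>z. max 0 (A (fst z) + B (snd z)) \<partial>\<gamma>)"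
    using A B i by (intro integral_mono) auto
  finally have "ennreal (kant_dual \<Omega> p \<mu> \<nu> \<xi>) \<le> ennreal (\<integral>z. max 0 (A (fst z) + B (snd z)) \<partial>\<gamma>)"
    by (rule ennreal_leI)
  also have "\<dots> = (\<integral>\<^sup>+z. ennreal (max 0 (A (fst z) + B (snd z))) \<partial>\<gamma>)"
    using i by (intro nn_integral_eq_integral[symmetric]) auto
  also have "\<dots> \<le> (\<integral>\<^sup>+z. ennreal (c (fst z) (snd z)) \<partial>\<gamma>)"
    using le by (intro nn_integral_mono_AE) (auto elim!: eventually_mono intro!: ennreal_leI)
  finally show "ennreal (kant_dual \<Omega> p \<mu> \<nu> \<xi>) \<le> (\<integral>\<^sup>+z. ennreal (c (fst z) (snd z)) \<partial>\<gamma>)" .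
qed

text \<open>The set of points of \<open>U\<close> with \<open>h\<close> positive is open and
  \<open>\<nu>\<close>-null, hence Lebesgue-null by \<open>full\<close>, hence empty. Continuity
  extends the zero value to the closure.\<close>

lemma continuous_eq_0_if_integral_le_0:
  fixes h :: "'a \<Rightarrow> real"
  assumes U: "open U" "\<Omega> = closure U" and nu: "\<nu> \<in> prob_on \<Omega>"
    and full: "\<And>A. A \<in> sets borel \<Longrightarrow> A \<subseteq> \<Omega> \<Longrightarrow> emeasure \<nu> A = 0 \<Longrightarrow> emeasure lborel A = 0"
    and h: "continuous_on \<Omega> h" "\<And>x. x \<in> \<Omega> \<Longrightarrow> 0 \<le> h x" "(LINT x:\<Omega>|\<nu>. h x) \<le> 0"
    and y: "y \<in> \<Omega>"
  shows "h y = 0"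
proof -
  have nuS: "sets \<nu> = sets borel" using nu by (simp add: prob_on_def)
  have sp: "space \<nu> = UNIV" using sets_eq_imp_space_eq[OF nuS] by simp
  let ?h = "\<lambda>x. indicator \<Omega> x *\<^sub>R h x"
  have i: "integrable \<nu> ?h" using set_integrable_continuous[OF h(1) nu] by (simp add: set_integrable_def)
  have pos: "0 \<le> ?h x" for x using h(2) by (simp add: indicator_def)
  have "(\<integral>x. ?h x \<partial>\<nu>) = 0"
    by (rule antisym, use h(3) in \<open>simp add: set_lebesgue_integral_def\<close>)
      (rule Bochner_Integration.integral_nonneg, rule pos)
  then have h0: "AE x in \<nu>. ?h x = 0" using integral_nonneg_eq_0_iff_AE[OF i] pos by simp
  have UO: "U \<subseteq> \<Omega>" using U closure_subset by auto
  define V where "V = U \<inter> h -` {0<..}"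
  have V: "open V" unfolding V_def
    by (rule continuous_open_preimage[OF continuous_on_subset[OF h(1) UO] U(1)]) simp
  have "AE x in \<nu>. x \<notin> V"
    using h0
  proof eventually_elim
    case (elim x)
    then show ?case using UO by (auto simp: V_def indicator_def split: if_splits)
  qed
  then have "emeasure \<nu> V = 0"
    using V by (subst (asm) AE_iff_measurable[of V]) (auto simp: nuS sp)
  then have "emeasure lborel V = 0" using V UO by (intro full) (auto simp: V_def)
  then have "V = {}" using open_imp_emeasure_lborel_pos[OF V] by blast
  then have "h x = 0" if "x \<in> U" for x
    using h(2)[of x] UO that by (force simp: V_def)
  then show ?thesis using continuous_constant_on_closure[of U h 0 y] h(1) y U(2) by blast
qed

text \<open>Truncating \<open>\<phi>\<close> at 0 keeps its \<open>\<mu>\<close>-integral and can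
  only raise its transform, so optimality makes the two transforms agree on \<open>\<Omega>\<close>.
  At a point with \<open>\<phi> y > 0\<close>, the competitor \<open>x = y\<close> has cost 0 and
  makes \<open>ct \<phi> y\<close> negative, while the truncation has a nonnegative
  transform.\<close>

lemma potential_nonpos:
  assumes U: "open U" "\<Omega> = closure U"
    and mu: "\<mu> \<in> prob_on \<Omega>" and nu: "\<nu> \<in> prob_on \<Omega>"
    and full: "\<And>A. A \<in> sets borel \<Longrightarrow> A \<subseteq> \<Omega> \<Longrightarrow> emeasure \<nu> A = 0 \<Longrightarrow> emeasure lborel A = 0"
    and pot: "kantorovich_potential \<Omega> p \<mu> \<nu> \<phi>"
    and le: "AE x in \<mu>. x \<in> \<Omega> \<longrightarrow> \<phi> x \<le> 0"
    and y: "y \<in> \<Omega>"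
  shows "\<phi> y \<le> 0"
proof (rule ccontr)
  assume neg: "\<not> \<phi> y \<le> 0"
  have \<phi>: "continuous_on \<Omega> \<phi>" using pot by (intro c_concave_continuous) (simp add: kantorovich_potential_def)
  define \<xi> where "\<xi> x = min (\<phi> x) 0" for x
  have \<xi>: "continuous_on \<Omega> \<xi>" unfolding \<xi>_def by (intro continuous_intros \<phi>)
  note \<phi>c = continuous_on_ctrans_continuous[OF \<phi>] and \<xi>c = continuous_on_ctrans_continuous[OF \<xi>]
  have muS: "sets \<mu> = sets borel" using mu by (simp add: prob_on_def)
  have eq: "(LINT x:\<Omega>|\<mu>. \<xi> x) = (LINT x:\<Omega>|\<mu>. \<phi> x)"
    unfolding set_lebesgue_integral_def
  proof (rule integral_cong_AE)
    show "AE x in \<mu>. indicator \<Omega> x *\<^sub>R \<xi> x = indicator \<Omega> x *\<^sub>R \<phi> x"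
      using le by eventually_elim (auto simp: \<xi>_def indicator_def)
  qed (use set_integrable_continuous[OF \<phi> mu] set_integrable_continuous[OF \<xi> mu] in \<open>auto simp: set_integrable_def\<close>)
  have ge: "ct \<phi> x \<le> ct \<xi> x" for x
    by (rule ctrans_antimono[OF bdd_above_continuous[OF \<phi>]]) (simp add: \<xi>_def)
  have "(LINT x:\<Omega>|\<nu>. ct \<xi> x) \<le> (LINT x:\<Omega>|\<nu>. ct \<phi> x)"
    using kant_dual_le_potential[OF pot \<xi> mu nu] eq by (simp add: kant_dual_def)
  then have "(LINT x:\<Omega>|\<nu>. ct \<xi> x - ct \<phi> x) \<le> 0"
    using set_integral_diff(2)[OF set_integrable_continuous[OF \<xi>c nu] set_integrable_continuous[OF \<phi>c nu]] by simp
  then have "ct \<xi> y - ct \<phi> y = 0"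
    by (intro continuous_eq_0_if_integral_le_0[OF U nu full, where h = "\<lambda>x. ct \<xi> x - ct \<phi> x"])
      (auto intro!: continuous_intros \<xi>c \<phi>c y simp: ge)
  moreover have "0 \<le> ct \<xi> y"
  proof (rule ctrans_greatest)
    fix x
    have "\<xi> x \<le> 0" "0 \<le> c x y" by (simp_all add: \<xi>_def)
    then show "0 \<le> c x y - \<xi> x" by linarith
  qed
  moreover have "ct \<phi> y \<le> c y y - \<phi> y" by (rule ctrans_le[OF bdd_above_continuous[OF \<phi>] y])
  ultimately show False using neg by simp
qed

text \<open>The transform is concave, so the midpoint of two potentials has a dual value at least as
  large; optimality then removes the gap \<open>h\<close>, and the two potentials share contact
  points at every \<open>y\<close>.\<close>

lemma potential_unique:
  assumes U: "open U" "connected U" "\<Omega> = closure U"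
    and mu: "\<mu> \<in> prob_on \<Omega>" and nu: "\<nu> \<in> prob_on \<Omega>"
    and full: "\<And>A. A \<in> sets borel \<Longrightarrow> A \<subseteq> \<Omega> \<Longrightarrow> emeasure \<nu> A = 0 \<Longrightarrow> emeasure lborel A = 0"
    and pot1: "kantorovich_potential \<Omega> p \<mu> \<nu> \<phi>" and pot2: "kantorovich_potential \<Omega> p \<mu> \<nu> \<psi>"
  shows "\<exists>k. \<forall>x\<in>\<Omega>. \<psi> x = \<phi> x + k"
proof -
  have cc: "c_concave \<Omega> p \<phi>" "c_concave \<Omega> p \<psi>" using pot1 pot2 by (auto simp: kantorovich_potential_def)
  have \<phi>: "continuous_on \<Omega> \<phi>" and \<psi>: "continuous_on \<Omega> \<psi>" using cc by (auto intro: c_concave_continuous)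
  define \<xi> where "\<xi> x = (1/2) * \<phi> x + (1/2) * \<psi> x" for x
  have \<xi>: "continuous_on \<Omega> \<xi>" unfolding \<xi>_def by (intro continuous_intros \<phi> \<psi>)
  note \<phi>c = continuous_on_ctrans_continuous[OF \<phi>] and \<psi>c = continuous_on_ctrans_continuous[OF \<psi>] and \<xi>c = continuous_on_ctrans_continuous[OF \<xi>]
  define h where "h y = ct \<xi> y - ((1/2) * ct \<phi> y + (1/2) * ct \<psi> y)" for y
  have hc: "continuous_on \<Omega> h" unfolding h_def by (intro continuous_intros \<phi>c \<psi>c \<xi>c)
  have le: "ct \<phi> y \<le> c x y - \<phi> x" "ct \<psi> y \<le> c x y - \<psi> x" if "x \<in> \<Omega>" for x y
    by (rule ctrans_le[OF bdd_above_continuous[OF \<phi>] that], rule ctrans_le[OF bdd_above_continuous[OF \<psi>] that])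
  have h0: "0 \<le> h y" for y
  proof -
    have "(1/2) * ct \<phi> y + (1/2) * ct \<psi> y \<le> ct \<xi> y"
    proof (rule ctrans_greatest)
      fix x assume "x \<in> \<Omega>"
      then show "(1/2) * ct \<phi> y + (1/2) * ct \<psi> y \<le> c x y - \<xi> x" using le[of x y] by (simp add: \<xi>_def)
    qed
    then show ?thesis by (simp add: h_def)
  qed
  have same: "kant_dual \<Omega> p \<mu> \<nu> \<phi> = kant_dual \<Omega> p \<mu> \<nu> \<psi>"
    using pot1 pot2 by (auto simp: kantorovich_potential_def intro!: antisym)
  have i: "set_integrable M \<Omega> k" if "continuous_on \<Omega> k" "M \<in> {\<mu>, \<nu>}" for M and k :: "'a \<Rightarrow> real"
    using set_integrable_continuous[of k M] that mu nu by auto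
  have I\<xi>: "(LINT x:\<Omega>|\<mu>. \<xi> x) = (1/2) * (LINT x:\<Omega>|\<mu>. \<phi> x) + (1/2) * (LINT x:\<Omega>|\<mu>. \<psi> x)"
    unfolding \<xi>_def by (subst set_integral_add(2)) (auto intro!: i \<phi> \<psi>)
  have Ih: "(LINT x:\<Omega>|\<nu>. h x) = (LINT x:\<Omega>|\<nu>. ct \<xi> x) - ((1/2) * (LINT x:\<Omega>|\<nu>. ct \<phi> x) + (1/2) * (LINT x:\<Omega>|\<nu>. ct \<psi> x))"
    unfolding h_def
    by (subst set_integral_diff(2), simp add: i \<xi>c, rule set_integral_add(1), simp add: i \<phi>c, simp add: i \<psi>c,
        subst set_integral_add(2)) (auto intro!: i \<phi>c \<psi>c)
  have "(LINT x:\<Omega>|\<nu>. h x) \<le> 0"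
    using kant_dual_le_potential[OF pot2 \<xi> mu nu] same unfolding Ih kant_dual_def I\<xi> by linarith
  then have hz: "h y = 0" if "y \<in> \<Omega>" for y
    using continuous_eq_0_if_integral_le_0[OF U(1,3) nu full hc _ _ that] h0 by blast
  have contact: "\<exists>x\<in>\<Omega>. ct \<phi> y = c x y - \<phi> x \<and> ct \<psi> y = c x y - \<psi> x" if y: "y \<in> \<Omega>" for y
  proof -
    \<comment> \<open>At a minimiser for \<open>\<xi>\<close>, \<open>h y = 0\<close> is equality in
      the average of two inequalities, so each of them is an equality.\<close>
    obtain x where x: "x \<in> \<Omega>" "ct \<xi> y = c x y - \<xi> x" using ctrans_attained[OF \<xi>] by blast
    have "ct \<phi> y = c x y - \<phi> x" "ct \<psi> y = c x y - \<psi> x"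
      using hz[OF y] le[OF x(1), of y] x(2) unfolding h_def \<xi>_def by linarith+
    then show ?thesis using x(1) by blast
  qed
  obtain k where k: "\<And>y. y \<in> \<Omega> \<Longrightarrow> ct \<phi> y - ct \<psi> y = k"
    using ctrans_diff_constant[OF \<phi> \<psi> contact U] by blast
  \<comment> \<open>By c-concavity each potential is the transform of its own transform;
    transforming back turns the constant difference \<open>k\<close> of the transforms into the
    difference of the potentials with opposite sign.\<close>
  have "\<psi> x = \<phi> x + k" if x: "x \<in> \<Omega>" for x
  proof -
    have 1: "ct (ct \<phi>) x = \<phi> x" "ct (ct \<psi>) x = \<psi> x" using c_concave_ctrans_ctrans cc x by auto
    have "\<psi> x - k \<le> ct (ct \<phi>) x"
    proof (rule ctrans_greatest)
      fix y assume "y \<in> \<Omega>"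
      then show "\<psi> x - k \<le> c y x - ct \<phi> y"
        using ctrans_le[OF bdd_above_continuous[OF \<psi>c], of y x] k[of y] 1 by simp
    qed
    moreover have "\<phi> x + k \<le> ct (ct \<psi>) x"
    proof (rule ctrans_greatest)
      fix y assume "y \<in> \<Omega>"
      then show "\<phi> x + k \<le> c y x - ct \<psi> y"
        using ctrans_le[OF bdd_above_continuous[OF \<phi>c], of y x] k[of y] 1 by simp
    qed
    ultimately show ?thesis using 1 by simp
  qed
  then show ?thesis by blast
qed


text \<open>Combines the first variation with the near-optimal plans and lets their error tend to 0.
  The function \<open>g\<close> is a transform of \<open>- f' (u x)\<close> that ignores a
  Lebesgue-null set of points \<open>x\<close>.\<close>

lemma minimizer_duality:
  assumes f: "standing_f f f'" and nu: "\<nu> \<in> prob_on \<Omega>"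
    and u_meas[measurable]: "u \<in> borel_measurable borel" and u: "\<forall>x. 0 \<le> u x"
    and mu_def: "\<mu> = density lborel (\<lambda>x. ennreal (u x))" and mu: "\<mu> \<in> prob_on \<Omega>"
    and min: "\<forall>\<mu>'\<in>prob_on \<Omega>. Ffun p f \<Omega> \<nu> \<mu> \<le> Ffun p f \<Omega> \<nu> \<mu>'"
    and \<Omega>pos: "emeasure lborel \<Omega> \<noteq> 0"
  obtains g where "continuous_on \<Omega> g" "\<And>y. 0 \<le> g y"
    "AE x in lborel. x \<in> \<Omega> \<longrightarrow> (\<forall>y. g y \<le> c x y + f' (u x))"
    "(\<integral>\<^sup>+x\<in>\<Omega>. ennreal (f' (u x) * u x) \<partial>lborel) + Tp p \<mu> \<nu> \<le> (\<integral>\<^sup>+y\<in>\<Omega>. ennreal (g y) \<partial>\<nu>)"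
proof -
  define a where "a x = f' (u x)" for x
  have [measurable]: "a \<in> borel_measurable borel" unfolding a_def
    by (rule borel_measurable_compose_nonneg) (use f u in \<open>auto simp: standing_f_def\<close>)
  have a0: "0 \<le> a x" for x using standing_f_deriv_nonneg[OF f] u by (simp add: a_def)
  \<comment> \<open>The points whose pair \<open>(x, a x)\<close> lies in the support of the graph
    measure over \<open>\<Omega>\<close>. Almost all of \<open>\<Omega>\<close> belongs to
    \<open>E\<close>, and near any of its pairs there is positive mass to transport.\<close>
  define E where "E = {x\<in>\<Omega>. \<forall>V. open V \<longrightarrow> (x, a x) \<in> V \<longrightarrow> emeasure lborel {x'\<in>\<Omega>. (x', a x') \<in> V} \<noteq> 0}"
  have AE_E: "AE x in lborel. x \<in> \<Omega> \<longrightarrow> x \<in> E"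
  proof -
    let ?L = "density lborel (indicator \<Omega>) :: 'a measure"
    have "(\<lambda>x. (x, a x)) \<in> borel_measurable ?L" by (simp add: borel_prod[symmetric])
    from AE_in_support[OF this]
    have "AE x in ?L. \<forall>V. open V \<longrightarrow> (x, a x) \<in> V \<longrightarrow> emeasure ?L ((\<lambda>x. (x, a x)) -` V) \<noteq> 0" by simp
    then have "AE x in lborel. x \<in> \<Omega> \<longrightarrow> (\<forall>V. open V \<longrightarrow> (x, a x) \<in> V \<longrightarrow> emeasure ?L ((\<lambda>x. (x, a x)) -` V) \<noteq> 0)"
      by (subst (asm) AE_density) (auto simp: indicator_def elim!: eventually_mono)
    moreover have "emeasure ?L ((\<lambda>x. (x, a x)) -` V) = emeasure lborel {x'\<in>\<Omega>. (x', a x') \<in> V}" if V: "open V" for V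
    proof -
      have "V \<in> sets (borel \<Otimes>\<^sub>M borel)" unfolding borel_prod using V by (rule borel_open)
      then have [measurable]: "(\<lambda>x. (x, a x)) -` V \<in> sets borel"
        using measurable_sets[of "\<lambda>x. (x, a x)" borel "borel \<Otimes>\<^sub>M borel" V] by simp
      have "emeasure ?L ((\<lambda>x. (x, a x)) -` V) = (\<integral>\<^sup>+x. indicator \<Omega> x * indicator ((\<lambda>x. (x, a x)) -` V) x \<partial>lborel)"
        by (rule emeasure_density) measurable
      also have "\<dots> = (\<integral>\<^sup>+x. indicator (\<Omega> \<inter> (\<lambda>x. (x, a x)) -` V) x \<partial>lborel)"
        by (intro nn_integral_cong) (auto simp: indicator_def)
      also have "\<dots> = emeasure lborel (\<Omega> \<inter> (\<lambda>x. (x, a x)) -` V)" by simp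
      also have "\<Omega> \<inter> (\<lambda>x. (x, a x)) -` V = {x'\<in>\<Omega>. (x', a x') \<in> V}" by auto
      finally show ?thesis .
    qed
    ultimately show ?thesis by (auto simp: E_def elim!: eventually_mono)
  qed
  have E: "E \<subseteq> \<Omega>" "E \<noteq> {}"
  proof -
    show "E \<subseteq> \<Omega>" by (auto simp: E_def)
    show "E \<noteq> {}"
    proof
      assume "E = {}"
      then have "AE x in lborel. x \<notin> \<Omega>" using AE_E by simp
      then have "emeasure lborel \<Omega> = 0" by (subst (asm) AE_iff_measurable[of \<Omega>]) auto
      then show False using \<Omega>pos by simp
    qed
  qed
  have supp: "emeasure lborel {x'\<in>\<Omega>. (x', a x') \<in> V} \<noteq> 0" if "x \<in> E" "open V" "(x, a x) \<in> V" for x V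
    using that by (auto simp: E_def)
  define g where "g y = (INF x\<in>E. c x y - (- a x))" for y
  have bd: "bdd_above ((\<lambda>x. - a x) ` E)" using a0 by (intro bdd_aboveI2[where M=0]) auto
  have gcont: "continuous_on \<Omega> g" unfolding g_def by (rule continuous_on_inf_cost[OF E bd])
  have [measurable]: "(\<lambda>y. indicator \<Omega> y * g y) \<in> borel_measurable borel"
    by (rule borel_measurable_indicator_continuous[OF gcont])
  have gpos: "0 \<le> g y" for y unfolding g_def using a0 E by (intro cINF_greatest) auto
  have gle: "g y \<le> c x y + a x" if "x \<in> E" for x y
    using cINF_lower[OF bdd_below_cost[OF bd] that, of y] by (simp add: g_def)
  have nuS[measurable_cong]: "sets \<nu> = sets borel" and nuP: "prob_space \<nu>" using nu by (auto simp: prob_on_def)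
  interpret nu: prob_space \<nu> by (rule nuP)
  have "(\<integral>\<^sup>+x\<in>\<Omega>. ennreal (f' (u x) * u x) \<partial>lborel) + Tp p \<mu> \<nu> \<le> (\<integral>\<^sup>+y\<in>\<Omega>. ennreal (g y) \<partial>\<nu>)"
  proof (rule ennreal_le_epsilon)
    fix \<delta> :: real assume \<delta>: "0 < \<delta>"
    have "\<exists>w K \<gamma>. w \<in> borel_measurable borel \<and> (\<forall>x. 0 \<le> w x) \<and> (\<forall>x. w x \<le> K) \<and> (\<forall>x. x \<notin> \<Omega> \<longrightarrow> w x = 0) \<and>
     \<gamma> \<in> transport_plans (density lborel (\<lambda>x. ennreal (w x))) \<nu> \<and>
     (\<integral>\<^sup>+x\<in>\<Omega>. ennreal (a x * w x) \<partial>lborel) + (\<integral>\<^sup>+z. ennreal (c (fst z) (snd z)) \<partial>\<gamma>) \<le> (\<integral>\<^sup>+y\<in>\<Omega>. ennreal (g y + \<delta>) \<partial>\<nu>)"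
      unfolding g_def by (rule ex_near_optimal_plan[OF _ a0 nu E _ \<delta>]) (simp, rule supp)
    then obtain w K \<gamma> where w: "w \<in> borel_measurable borel" "\<forall>x. 0 \<le> w x" "\<forall>x. w x \<le> K" "\<forall>x. x \<notin> \<Omega> \<longrightarrow> w x = 0"
     and \<gamma>: "\<gamma> \<in> transport_plans (density lborel (\<lambda>x. ennreal (w x))) \<nu>"
     and le: "(\<integral>\<^sup>+x\<in>\<Omega>. ennreal (a x * w x) \<partial>lborel) + (\<integral>\<^sup>+z. ennreal (c (fst z) (snd z)) \<partial>\<gamma>) \<le> (\<integral>\<^sup>+y\<in>\<Omega>. ennreal (g y + \<delta>) \<partial>\<nu>)"
      by blast
    have "(\<integral>\<^sup>+x\<in>\<Omega>. ennreal (f' (u x) * u x) \<partial>lborel) + Tp p \<mu> \<nu>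
        \<le> (\<integral>\<^sup>+x\<in>\<Omega>. ennreal (a x * w x) \<partial>lborel) + (\<integral>\<^sup>+z. ennreal (c (fst z) (snd z)) \<partial>\<gamma>)"
      unfolding a_def
      by (rule first_variation[OF f \<Omega>_borel emeasure_\<Omega>_finite u_meas u mu_def mu min w(1) _ _ _ \<gamma>]) (use w in auto)
    also note le
    also have "(\<integral>\<^sup>+y\<in>\<Omega>. ennreal (g y + \<delta>) \<partial>\<nu>) \<le> (\<integral>\<^sup>+y. ennreal (indicator \<Omega> y * g y) + ennreal \<delta> \<partial>\<nu>)"
      using gpos \<delta> by (intro nn_integral_mono) (auto simp: indicator_def)
    also have "\<dots> = (\<integral>\<^sup>+y. ennreal (indicator \<Omega> y * g y) \<partial>\<nu>) + (\<integral>\<^sup>+y. ennreal \<delta> \<partial>\<nu>)"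
      by (rule nn_integral_add) measurable
    also have "(\<integral>\<^sup>+y. ennreal \<delta> \<partial>\<nu>) = ennreal \<delta>" by (simp add: nu.emeasure_space_1)
    also have "(\<integral>\<^sup>+y. ennreal (indicator \<Omega> y * g y) \<partial>\<nu>) = (\<integral>\<^sup>+y\<in>\<Omega>. ennreal (g y) \<partial>\<nu>)"
      by (intro nn_integral_cong) (auto simp: indicator_def)
    finally show "(\<integral>\<^sup>+x\<in>\<Omega>. ennreal (f' (u x) * u x) \<partial>lborel) + Tp p \<mu> \<nu> \<le> (\<integral>\<^sup>+y\<in>\<Omega>. ennreal (g y) \<partial>\<nu>) + ennreal \<delta>" .
  qed
  moreover have "AE x in lborel. x \<in> \<Omega> \<longrightarrow> (\<forall>y. g y \<le> c x y + f' (u x))"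
    using AE_E by eventually_elim (use gle in \<open>auto simp: a_def\<close>)
  ultimately show thesis using that[OF gcont gpos] by blast
qed

text \<open>For \<open>\<phi> = ct g\<close>, the bounds \<open>\<phi> \<ge> - f' (u x)\<close> a.e.
  and \<open>ct \<phi> \<ge> g\<close> lift the dual value to at least the transport cost. Weak
  duality forces equality throughout, which gives optimality and complementary slackness.\<close>

lemma minimizer_potential:
  assumes f: "standing_f f f'" and nu: "\<nu> \<in> prob_on \<Omega>"
    and u_meas[measurable]: "u \<in> borel_measurable borel" and u: "\<forall>x. 0 \<le> u x"
    and mu_def: "\<mu> = density lborel (\<lambda>x. ennreal (u x))" and mu: "\<mu> \<in> prob_on \<Omega>"
    and min: "\<forall>\<mu>'\<in>prob_on \<Omega>. Ffun p f \<Omega> \<nu> \<mu> \<le> Ffun p f \<Omega> \<nu> \<mu>'"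
    and \<Omega>pos: "emeasure lborel \<Omega> \<noteq> 0"
  obtains \<phi> where "kantorovich_potential \<Omega> p \<mu> \<nu> \<phi>"
    "AE x in lborel. x \<in> \<Omega> \<longrightarrow> - f' (u x) \<le> \<phi> x"
    "AE x in lborel. x \<in> \<Omega> \<longrightarrow> 0 < u x \<longrightarrow> \<phi> x = - f' (u x)"
proof -
  obtain g where gcont: "continuous_on \<Omega> g" and gpos: "\<And>y. 0 \<le> g y"
    and gAE: "AE x in lborel. x \<in> \<Omega> \<longrightarrow> (\<forall>y. g y \<le> c x y + f' (u x))"
    and dual: "(\<integral>\<^sup>+x\<in>\<Omega>. ennreal (f' (u x) * u x) \<partial>lborel) + Tp p \<mu> \<nu> \<le> (\<integral>\<^sup>+y\<in>\<Omega>. ennreal (g y) \<partial>\<nu>)"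
    using minimizer_duality[OF assms] by blast
  define \<phi> where "\<phi> = ct g"
  have \<phi>: "continuous_on \<Omega> \<phi>" unfolding \<phi>_def by (rule continuous_on_ctrans_continuous[OF gcont])
  have ge: "AE x in lborel. x \<in> \<Omega> \<longrightarrow> - f' (u x) \<le> \<phi> x"
    using gAE
  proof eventually_elim
    case (elim x)
    show ?case
    proof
      assume x: "x \<in> \<Omega>"
      show "- f' (u x) \<le> \<phi> x" unfolding \<phi>_def
      proof (rule ctrans_greatest)
        fix y
        have "g y \<le> c x y + f' (u x)" using elim x by blast
        then show "- f' (u x) \<le> c y x - g y" by (simp add: dist_commute)
      qed
    qed
  qed
  have [measurable]: "(\<lambda>x. f' (u x)) \<in> borel_measurable borel"
    by (rule borel_measurable_compose_nonneg) (use f u in \<open>auto simp: standing_f_def\<close>)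
  have a0: "0 \<le> f' (u x)" for x using standing_f_deriv_nonneg[OF f] u by blast
  have gi: "set_integrable \<nu> \<Omega> g" by (rule set_integrable_continuous[OF gcont nu])
  define D where "D = (LINT y:\<Omega>|\<nu>. g y)"
  have D: "(\<integral>\<^sup>+y\<in>\<Omega>. ennreal (g y) \<partial>\<nu>) = ennreal D"
  proof -
    have "(\<integral>\<^sup>+y\<in>\<Omega>. ennreal (g y) \<partial>\<nu>) = (\<integral>\<^sup>+y. ennreal (indicator \<Omega> y *\<^sub>R g y) \<partial>\<nu>)"
      by (intro nn_integral_cong) (auto simp: indicator_def)
    also have "\<dots> = ennreal D"
      unfolding D_def set_lebesgue_integral_def using gi gpos
      by (intro nn_integral_eq_integral) (auto simp: set_integrable_def)
    finally show ?thesis .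
  qed
  let ?s = "\<lambda>x. indicator \<Omega> x * (f' (u x) * u x)"
  have seq: "(\<integral>\<^sup>+x\<in>\<Omega>. ennreal (f' (u x) * u x) \<partial>lborel) = (\<integral>\<^sup>+x. ennreal (?s x) \<partial>lborel)"
    by (intro nn_integral_cong) (auto simp: indicator_def)
  \<comment> \<open>Integrability of \<open>f' (u x) * u x\<close> over \<open>\<Omega>\<close> is a
    consequence of the dual estimate: \<open>g\<close> is continuous on a compact set, so
    \<open>D\<close> is finite.\<close>
  have "(\<integral>\<^sup>+x. ennreal (?s x) \<partial>lborel) \<le> ennreal D"
    using dual unfolding D seq by (meson add_increasing2 le_iff_add order_trans zero_le)
  then have si: "integrable lborel ?s"
    using a0 u by (intro integrableI_nonneg) (auto simp: top_unique less_top[symmetric])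
  define S where "S = (\<integral>x. ?s x \<partial>lborel)"
  have S: "(\<integral>\<^sup>+x. ennreal (?s x) \<partial>lborel) = ennreal S" "0 \<le> S"
    unfolding S_def using si a0 u by (auto intro!: nn_integral_eq_integral)
  have "Tp p \<mu> \<nu> \<le> ennreal S + Tp p \<mu> \<nu>" by simp
  also have "\<dots> \<le> ennreal D" using dual unfolding D seq S .
  finally have Tfin: "Tp p \<mu> \<nu> < \<infinity>" by (auto simp: top_unique less_top[symmetric])
  define T where "T = enn2real (Tp p \<mu> \<nu>)"
  have T: "Tp p \<mu> \<nu> = ennreal T" "0 \<le> T" using Tfin by (auto simp: T_def)
  have D0: "0 \<le> D" unfolding D_def set_lebesgue_integral_def using gpos by (intro Bochner_Integration.integral_nonneg) auto
  have "ennreal (S + T) \<le> ennreal D" using dual unfolding D seq S(1) T(1) using S(2) T(2) by simp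
  then have STD: "S + T \<le> D" using D0 by simp
  have weak: "kant_dual \<Omega> p \<mu> \<nu> \<xi> \<le> T" if "continuous_on \<Omega> \<xi>" for \<xi>
    using kant_dual_le_Tp[OF that mu nu] T by simp
  have \<phi>mu: "(LINT x:\<Omega>|\<mu>. \<phi> x) = (\<integral>x. u x * (indicator \<Omega> x * \<phi> x) \<partial>lborel)"
    and \<phi>i: "integrable lborel (\<lambda>x. u x * (indicator \<Omega> x * \<phi> x))"
  proof -
    have m[measurable]: "(\<lambda>x. indicator \<Omega> x * \<phi> x) \<in> borel_measurable borel"
      by (rule borel_measurable_indicator_continuous[OF \<phi>])
    show "(LINT x:\<Omega>|\<mu>. \<phi> x) = (\<integral>x. u x * (indicator \<Omega> x * \<phi> x) \<partial>lborel)"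
      unfolding set_lebesgue_integral_def mu_def using u by (subst integral_density) auto
    have "integrable \<mu> (\<lambda>x. indicator \<Omega> x * \<phi> x)"
      using set_integrable_continuous[OF \<phi> mu] by (simp add: set_integrable_def)
    then show "integrable lborel (\<lambda>x. u x * (indicator \<Omega> x * \<phi> x))"
      unfolding mu_def using u by (subst (asm) integrable_density) auto
  qed
  let ?r = "\<lambda>x. u x * (indicator \<Omega> x * \<phi> x) + ?s x"
  have ri: "integrable lborel ?r" using \<phi>i si by auto
  have r0: "AE x in lborel. 0 \<le> ?r x"
    using ge
  proof eventually_elim
    case (elim x)
    have "?r x = u x * (indicator \<Omega> x * (\<phi> x + f' (u x)))" by (simp add: algebra_simps)
    also have "\<dots> \<ge> 0" using elim u by (auto simp: indicator_def)
    finally show ?case .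
  qed
  have rI: "(\<integral>x. ?r x \<partial>lborel) = (LINT x:\<Omega>|\<mu>. \<phi> x) + S"
    unfolding \<phi>mu S_def using \<phi>i si by simp
  have Dle: "D \<le> (LINT y:\<Omega>|\<nu>. ct \<phi> y)"
    unfolding D_def \<phi>_def
    by (intro set_integral_mono gi set_integrable_continuous continuous_on_ctrans_continuous gcont nu le_ctrans_ctrans bdd_above_continuous)
  have rI0: "0 \<le> (\<integral>x. ?r x \<partial>lborel)" by (rule integral_nonneg_AE[OF r0])
  have kd: "kant_dual \<Omega> p \<mu> \<nu> \<phi> = (LINT x:\<Omega>|\<mu>. \<phi> x) + (LINT y:\<Omega>|\<nu>. ct \<phi> y)" by (simp add: kant_dual_def)
  have Tle: "T \<le> kant_dual \<Omega> p \<mu> \<nu> \<phi>" using STD Dle rI rI0 kd by linarith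
  have pot: "kantorovich_potential \<Omega> p \<mu> \<nu> \<phi>"
    unfolding kantorovich_potential_def
  proof (intro conjI allI impI)
    show "c_concave \<Omega> p \<phi>" unfolding \<phi>_def by (rule c_concave_ctrans[OF bdd_above_continuous[OF gcont]])
    fix \<xi> assume "c_concave \<Omega> p \<xi>"
    then show "kant_dual \<Omega> p \<mu> \<nu> \<xi> \<le> kant_dual \<Omega> p \<mu> \<nu> \<phi>"
      using weak[OF c_concave_continuous] Tle by fastforce
  qed
  \<comment> \<open>The dual value of \<open>\<phi>\<close> is at most \<open>T\<close> and at least
    the integral of \<open>?r\<close> plus \<open>T\<close>, so this nonnegative integral is
    0.\<close>
  have "(\<integral>x. ?r x \<partial>lborel) = 0" using weak[OF \<phi>] STD Dle rI rI0 kd by linarith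
  then have "AE x in lborel. ?r x = 0" using integral_nonneg_eq_0_iff_AE[OF ri r0] by simp
  then have "AE x in lborel. x \<in> \<Omega> \<longrightarrow> 0 < u x \<longrightarrow> \<phi> x = - f' (u x)"
  proof eventually_elim
    case (elim x)
    show ?case
    proof (intro impI)
      assume x: "x \<in> \<Omega>" "0 < u x"
      then have "u x * (\<phi> x + f' (u x)) = 0" using elim by (simp add: algebra_simps)
      then show "\<phi> x = - f' (u x)" using x by simp
    qed
  qed
  then show thesis by (rule that[OF pot ge])
qed

end

section \<open>The density formula for an arbitrary potential\<close>

theorem theorem3p3:
  fixes \<Omega> :: "'a::euclidean_space set"
    and p :: real
    and f f' :: "real \<Rightarrow> real"
    and \<nu> \<mu> \<nu>s :: "'a measure"
    and v u \<psi> :: "'a \<Rightarrow> real"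
  assumes dom: "bounded_domain \<Omega>"
    and p: "p > 1"
    and f: "standing_f f f'"
    and nu: "\<nu> \<in> prob_on \<Omega>"
    and nus_sets: "sets \<nu>s = sets borel"
    and nus_sing: "\<exists>N\<in>null_sets lborel. emeasure \<nu>s (UNIV - N) = 0"
    and v_meas: "v \<in> borel_measurable borel"
    and v_Linf: "\<exists>C. AE x in lborel. x \<in> \<Omega> \<longrightarrow> \<bar>v x\<bar> \<le> C"
    and v_pos: "AE x in lborel. x \<in> \<Omega> \<longrightarrow> v x > 0"
    and nu_decomp: "\<forall>A\<in>sets borel.
        emeasure \<nu> A = emeasure \<nu>s A + (\<integral>\<^sup>+ x\<in>A \<inter> \<Omega>. ennreal (v x) \<partial>lborel)"
    and u_meas: "u \<in> borel_measurable borel"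
    and u_nonneg: "\<forall>x. 0 \<le> u x"
    and mu_def: "\<mu> = density lborel (\<lambda>x. ennreal (u x))"
    and mu: "\<mu> \<in> prob_on \<Omega>"
    and mu_min: "\<forall>\<mu>'\<in>prob_on \<Omega>. Ffun p f \<Omega> \<nu> \<mu> \<le> Ffun p f \<Omega> \<nu> \<mu>'"
    and psi: "kantorovich_potential \<Omega> p \<mu> \<nu> \<psi>"
  shows "\<exists>l::real. AE x in lborel. x \<in> \<Omega> \<longrightarrow>
           l - \<psi> x \<ge> 0 \<and> u x = the_inv_into {0..} f' (l - \<psi> x)"
proof -
  obtain U where U: "open U" "connected U" "U \<noteq> {}" "\<Omega> = closure U" and bnd: "bounded \<Omega>"
    using dom by (auto simp: bounded_domain_def)
  have UO: "U \<subseteq> \<Omega>" using U closure_subset by auto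
  interpret power_cost \<Omega> p
    by standard (use U UO bnd p in \<open>auto simp: compact_eq_bounded_closed\<close>)
  note [measurable] = v_meas u_meas
  \<comment> \<open>Positivity of \<open>v\<close> makes Lebesgue measure on \<open>\<Omega>\<close>
    absolutely continuous with respect to \<open>\<nu>\<close>; the singular part only adds
    mass.\<close>
  have full: "emeasure lborel A = 0" if A[measurable]: "A \<in> sets borel" and AO: "A \<subseteq> \<Omega>" and A0: "emeasure \<nu> A = 0" for A
  proof -
    have "(\<integral>\<^sup>+ x\<in>A \<inter> \<Omega>. ennreal (v x) \<partial>lborel) = 0" using nu_decomp A A0 by simp
    then have "AE x in lborel. ennreal (v x) * indicator (A \<inter> \<Omega>) x = 0"
      by (subst (asm) nn_integral_0_iff_AE) auto
    with v_pos have "AE x in lborel. x \<notin> A"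
    proof eventually_elim
      case (elim x)
      then show ?case using AO by (auto simp: indicator_def ennreal_eq_0_iff split: if_splits)
    qed
    then show ?thesis by (subst (asm) AE_iff_measurable[of A]) auto
  qed
  have \<Omega>pos: "emeasure lborel \<Omega> \<noteq> 0"
    using open_imp_emeasure_lborel_pos[OF U(1,3)] emeasure_mono[OF UO, of lborel] by auto
  obtain \<phi> where pot: "kantorovich_potential \<Omega> p \<mu> \<nu> \<phi>"
    and ge: "AE x in lborel. x \<in> \<Omega> \<longrightarrow> - f' (u x) \<le> \<phi> x"
    and eq: "AE x in lborel. x \<in> \<Omega> \<longrightarrow> 0 < u x \<longrightarrow> \<phi> x = - f' (u x)"
    using minimizer_potential[OF f nu u_meas u_nonneg mu_def mu mu_min \<Omega>pos] by blast
  have a0: "0 \<le> f' (u x)" for x using standing_f_deriv_nonneg[OF f] u_nonneg by blast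
  \<comment> \<open>The measure \<open>\<mu>\<close> sees only points with \<open>u x > 0\<close>,
    where \<open>\<phi> x = - f' (u x)\<close> and hence is nonpositive.\<close>
  have "AE x in \<mu>. x \<in> \<Omega> \<longrightarrow> \<phi> x \<le> 0"
    unfolding mu_def
  proof (subst AE_density)
    show "AE x in lborel. 0 < ennreal (u x) \<longrightarrow> x \<in> \<Omega> \<longrightarrow> \<phi> x \<le> 0"
      using eq by eventually_elim (use a0 in auto)
  qed simp
  then have nonpos: "\<phi> x \<le> 0" if "x \<in> \<Omega>" for x
    using potential_nonpos[OF U(1,4) mu nu full pot _ that] by blast
  obtain l where l: "\<And>x. x \<in> \<Omega> \<Longrightarrow> \<psi> x = \<phi> x + l"
    using potential_unique[OF U(1,2,4) mu nu full pot psi] by blast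
  have "AE x in lborel. x \<in> \<Omega> \<longrightarrow> l - \<psi> x \<ge> 0 \<and> u x = the_inv_into {0..} f' (l - \<psi> x)"
    using ge eq
  proof eventually_elim
    case (elim x)
    show ?case
    proof
      assume x: "x \<in> \<Omega>"
      have "\<phi> x = - f' (u x)"
      \<comment> \<open>Where \<open>u x = 0\<close>, the value is squeezed:
        \<open>0 = - f' 0 \<le> \<phi> x \<le> 0\<close>. Elsewhere complementary slackness gives
        the equality.\<close>
      proof (cases "u x = 0")
        case True
        then have "f' (u x) = 0" using f by (simp add: standing_f_def)
        then show ?thesis using elim(1) nonpos x by force
      next
        case False
        then have "0 < u x" using u_nonneg by (simp add: order_less_le)
        then show ?thesis using elim(2) x by blast
      qed
      then have "l - \<psi> x = f' (u x)" using l[OF x] by simp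
      moreover have "the_inv_into {0..} f' (f' (u x)) = u x"
        using u_nonneg by (intro the_inv_into_f_f[OF standing_f_inj[OF f]]) simp
      ultimately show "l - \<psi> x \<ge> 0 \<and> u x = the_inv_into {0..} f' (l - \<psi> x)"
        using a0 by simp
    qed
  qed
  then show ?thesis by blast
qed

end
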